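(* Let $B$ be a PSIT, $H\in\mathfrak M^B$ and $A\in\mathfrak V^B$. Then the following statements are equivalent: (i) $H$ is integrable on $B$ w.r.t. $A$. (ii) There exists an FS $(\tau_n)$ for $B$ such that for each $n\in\mathbb N^+$, $H^{\tau_n}$ is integrable w.r.t. $A^{\tau_n}$. (iii) There exist FCSs $(T_n,H^{(n)})$ for $H\in\mathfrak M^B$ and $(T_n,A^{(n)})$ for $A\in\mathfrak V^B$ such that for each $n\in\mathbb N^+$, $H^{(n)}$ is integrable w.r.t. $A^{(n)}$.
   Context: Fix a probability space $(\Omega,\mathcal F,\mathbb P)$ with a filtration $\mathbb F=(\mathcal F_t)_{t\ge0}$ satisfying the usual conditions; $\mathbb R^+=[0,+\infty[$, $\mathbb N^+=\{1,2,\dots\}$. A process is a family of real random variables indexed by $\mathbb R^+$; indistinguishable processes are regarded as the same ($X=Y$ means indistinguishability). For stopping times $S,T$, $[\![S,T]\!]=\{(\omega,t)\in\Omega\times\mathbb R^+:S(\omega)\le t\le T(\omega)\}$; $[\![S,T[\![$, $]\!]S,T]\!]$, $]\!]S,T[\![$ are defined analogously with strict inequality at open ends. $T_n\uparrow T$ means that $(T_n)$ is an increasing sequence of stopping times with limit $T$. Juxtaposition of sets means intersection. If $X$ is a real function on $\widetilde C\subseteq\Omega\times\mathbb R^+$, then $XI_C$ is the function on $\Omega\times\mathbb R^+$ equal to $X$ on $C\cap\widetilde C$ and $0$ elsewhere. A set $B\subseteq\Omega\times\mathbb R^+$ is a predictable set of interval type (PSIT) if it is predictable and there is a non-negative (possibly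 infinite) random variable $T$ such that each section $B_\omega=\{t:(\omega,t)\in B\}$ is nonempty and equals $[0,T(\omega)[$ or $[0,T(\omega)]$. The debut of $B^c$ is $\omega\mapsto\inf\{t:(\omega,t)\notin B\}$. A fundamental sequence (FS) for $B$ is an increasing sequence $(\tau_n)$ of stopping times with $B=\bigcup_n[\![0,\tau_n]\!]$ (one always exists). A process on $B$ is a real function $X$ on $B$ such that $XI_B$ is a process; processes $X,Y$ on $B$ are identified ($X=Y$) if $XI_B=YI_B$. A stopping time $\tau$ is a stopping time on $B$ if $[\![0,\tau]\!]\subseteq B$; then for a process $X$ on $B$, $X^\tau:=XI_{[\![0,\tau]\!]}+X_\tau I_{]\!]\tau,+\infty[\![}$ (a process on $\Omega\times\mathbb R^+$). Let $T$ be the debut of $B^c$. A coupled sequence (CS) for a process $X$ on $B$ is a sequence $(T_n,X^{(n)})_{n\in\mathbb N^+}$ with $T_n$ stopping times, $T_n\uparrow T$, $\bigcup_n[\![0,T_n]\!]\supseteq B$, $X^{(n)}$ processes, and $XI_{B[\![0,T_n]\!]}=X^{(n)}I_{B[\![0,T_n]\!]}$ for each $n$. For a class $\mathcal D$ of processes, $\mathcal D^B$ is the set of processes $X$ on $B$ having a CS with all $X^{(n)}\in\mathcal D$; such a CS is called a fundamental coupled sequence (FCS) for $X\in\mathcal D^B$. $\mathfrak M$ is the class of all measurable processes and $\mathfrak V$ the class of all (not necessarily adapted) processes with finite variation (c\`adl\`ag paths, of finite variation on bounded intervals). Pathwise integrals over $[0,t]$ include the mass at $0$: $\int_{[0,t]}H_s\,dA_s=H_0A_0+\int_{]0,t]}H_s\,dA_s$,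 and $\int_{[0,t]}|dA_s|$ is the variation process of $A$ (including $|A_0|$). For $H\in\mathfrak M$, $A\in\mathfrak V$, $H$ is integrable w.r.t. $A$ if $\int_{[0,t]}|H_s(\omega)||dA_s(\omega)|<+\infty$ for all $(\omega,t)\in\Omega\times\mathbb R^+$. For $H\in\mathfrak M^B$, $A\in\mathfrak V^B$, $H$ is integrable on $B$ w.r.t. $A$ if $\int_{[0,t]}|H_s(\omega)||dA_s(\omega)|<+\infty$ for all $(\omega,t)\in B$. *)

theory Defs
  imports "HOL-Probability.Probability"
begin

text \<open>
  The filtration is indexed by real numbers, of which only the non-negative ones matter.
  Random times take values in \<^typ>\<open>ennreal\<close>. Functions on subsets of
  \<open>\<Omega> \<times> [0,\<infinity>[\<close> are total functions on \<^typ>\<open>'a \<times> real\<close>, and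
  nothing below depends on their values outside the intended domain.
\<close>

locale usual_filtered_space = prob_space M + complete_measure M for M :: "'a measure" +
  fixes F :: "real \<Rightarrow> 'a measure"
  assumes F_subalgebra: "0 \<le> t \<Longrightarrow> subalgebra M (F t)"
    and F_mono: "0 \<le> s \<Longrightarrow> s \<le> t \<Longrightarrow> sets (F s) \<subseteq> sets (F t)"
    and F_right_continuous: "0 \<le> t \<Longrightarrow> sets (F t) = (\<Inter>u\<in>{t<..}. sets (F u))"
    and F_null: "null_sets M \<subseteq> sets (F 0)"

text \<open>
  The library constant \<^const>\<open>stopping_time\<close> takes its values in the index type of the
  filtration, which would exclude the value \<open>\<infinity>\<close> here.
\<close>

definition is_stopping_time :: "'a measure \<Rightarrow> (real \<Rightarrow> 'a measure) \<Rightarrow> ('a \<Rightarrow> ennreal) \<Rightarrow> bool" where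
  "is_stopping_time M F T \<longleftrightarrow> (\<forall>t\<ge>0. {\<omega> \<in> space M. T \<omega> \<le> ennreal t} \<in> sets (F t))"

definition stoch_Icc :: "'a measure \<Rightarrow> ('a \<Rightarrow> ennreal) \<Rightarrow> ('a \<Rightarrow> ennreal) \<Rightarrow> ('a \<times> real) set" where
  "stoch_Icc M S T = {(\<omega>, t). \<omega> \<in> space M \<and> 0 \<le> t \<and> S \<omega> \<le> ennreal t \<and> ennreal t \<le> T \<omega>}"

definition stoch_Ioo :: "'a measure \<Rightarrow> ('a \<Rightarrow> ennreal) \<Rightarrow> ('a \<Rightarrow> ennreal) \<Rightarrow> ('a \<times> real) set" where
  "stoch_Ioo M S T = {(\<omega>, t). \<omega> \<in> space M \<and> 0 \<le> t \<and> S \<omega> < ennreal t \<and> ennreal t < T \<omega>}"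

definition predictable_sigma :: "'a measure \<Rightarrow> (real \<Rightarrow> 'a measure) \<Rightarrow> ('a \<times> real) measure" where
  "predictable_sigma M F = sigma (space M \<times> {0..})
     ({C \<times> {0} | C. C \<in> sets (F 0)} \<union>
      {C \<times> {s<..t} | C s t. 0 \<le> s \<and> s < t \<and> C \<in> sets (F s)})"

definition psit :: "'a measure \<Rightarrow> (real \<Rightarrow> 'a measure) \<Rightarrow> ('a \<times> real) set \<Rightarrow> bool" where
  "psit M F B \<longleftrightarrow> B \<in> sets (predictable_sigma M F) \<and>
     (\<exists>T :: 'a \<Rightarrow> ennreal. T \<in> borel_measurable M \<and>
        (\<forall>\<omega>\<in>space M. {t. (\<omega>, t) \<in> B} \<noteq> {} \<and>
           ({t. (\<omega>, t) \<in> B} = {t. 0 \<le> t \<and> ennreal t < T \<omega>} \<or>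
            {t. (\<omega>, t) \<in> B} = {t. 0 \<le> t \<and> ennreal t \<le> T \<omega>})))"

text \<open>The debut of the complement of \<open>B\<close>; it is \<open>\<infinity>\<close> if the section is all of \<open>[0,\<infinity>[\<close>.\<close>

definition debut_compl :: "('a \<times> real) set \<Rightarrow> 'a \<Rightarrow> ennreal" where
  "debut_compl B \<omega> = Inf {ennreal t | t. 0 \<le> t \<and> (\<omega>, t) \<notin> B}"

definition fundamental_seq ::
  "'a measure \<Rightarrow> (real \<Rightarrow> 'a measure) \<Rightarrow> ('a \<times> real) set \<Rightarrow> (nat \<Rightarrow> 'a \<Rightarrow> ennreal) \<Rightarrow> bool" where
  "fundamental_seq M F B \<tau> \<longleftrightarrow>
     (\<forall>n. is_stopping_time M F (\<tau> n)) \<and>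
     (\<forall>\<omega>\<in>space M. incseq (\<lambda>n. \<tau> n \<omega>)) \<and>
     B = (\<Union>n. stoch_Icc M (\<lambda>_. 0) (\<tau> n))"

type_synonym 'a process = "'a \<times> real \<Rightarrow> real"

definition is_process :: "'a measure \<Rightarrow> 'a process \<Rightarrow> bool" where
  "is_process M X \<longleftrightarrow> (\<forall>t\<ge>0. (\<lambda>\<omega>. X (\<omega>, t)) \<in> borel_measurable M)"

definition indistinguishable :: "'a measure \<Rightarrow> 'a process \<Rightarrow> 'a process \<Rightarrow> bool" where
  "indistinguishable M X Y \<longleftrightarrow> (AE \<omega> in M. \<forall>t\<ge>0. X (\<omega>, t) = Y (\<omega>, t))"

definition restr :: "'a process \<Rightarrow> ('a \<times> real) set \<Rightarrow> 'a process" where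
  "restr X C = (\<lambda>p. X p * indicator C p)"

definition process_on :: "'a measure \<Rightarrow> ('a \<times> real) set \<Rightarrow> 'a process \<Rightarrow> bool" where
  "process_on M B X \<longleftrightarrow> is_process M (restr X B)"

text \<open>The value \<open>enn2real (\<tau> \<omega>)\<close> is used only where \<open>\<tau> \<omega>\<close> is finite.\<close>

definition stopped :: "'a measure \<Rightarrow> 'a process \<Rightarrow> ('a \<Rightarrow> ennreal) \<Rightarrow> 'a process" where
  "stopped M X \<tau> = (\<lambda>(\<omega>, t).
     restr X (stoch_Icc M (\<lambda>_. 0) \<tau>) (\<omega>, t) +
     X (\<omega>, enn2real (\<tau> \<omega>)) * indicator (stoch_Ioo M \<tau> (\<lambda>_. \<infinity>)) (\<omega>, t))"

definition coupled_seq ::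
  "'a measure \<Rightarrow> (real \<Rightarrow> 'a measure) \<Rightarrow> ('a \<times> real) set \<Rightarrow> 'a process \<Rightarrow>
   (nat \<Rightarrow> 'a \<Rightarrow> ennreal) \<Rightarrow> (nat \<Rightarrow> 'a process) \<Rightarrow> bool" where
  "coupled_seq M F B X T Xn \<longleftrightarrow>
     (\<forall>n. is_stopping_time M F (T n)) \<and>
     (\<forall>\<omega>\<in>space M. incseq (\<lambda>n. T n \<omega>) \<and> (\<lambda>n. T n \<omega>) \<longlonglongrightarrow> debut_compl B \<omega>) \<and>
     B \<subseteq> (\<Union>n. stoch_Icc M (\<lambda>_. 0) (T n)) \<and>
     (\<forall>n. is_process M (Xn n)) \<and>
     (\<forall>n. indistinguishable M (restr X (B \<inter> stoch_Icc M (\<lambda>_. 0) (T n)))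
                              (restr (Xn n) (B \<inter> stoch_Icc M (\<lambda>_. 0) (T n))))"

definition fund_coupled_seq ::
  "'a measure \<Rightarrow> (real \<Rightarrow> 'a measure) \<Rightarrow> ('a \<times> real) set \<Rightarrow> 'a process set \<Rightarrow> 'a process \<Rightarrow>
   (nat \<Rightarrow> 'a \<Rightarrow> ennreal) \<Rightarrow> (nat \<Rightarrow> 'a process) \<Rightarrow> bool" where
  "fund_coupled_seq M F B D X T Xn \<longleftrightarrow> coupled_seq M F B X T Xn \<and> (\<forall>n. Xn n \<in> D)"

definition class_on ::
  "'a measure \<Rightarrow> (real \<Rightarrow> 'a measure) \<Rightarrow> ('a \<times> real) set \<Rightarrow> 'a process set \<Rightarrow> 'a process set" where
  "class_on M F B D = {X. process_on M B X \<and> (\<exists>T Xn. fund_coupled_seq M F B D X T Xn)}"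

definition measurable_processes :: "'a measure \<Rightarrow> 'a process set" where
  "measurable_processes M = borel_measurable (M \<Otimes>\<^sub>M restrict_space borel {0..})"

definition variation :: "(real \<Rightarrow> real) \<Rightarrow> real \<Rightarrow> real \<Rightarrow> ennreal" where
  "variation a s t = (SUP xs\<in>{xs. sorted xs \<and> set xs \<subseteq> {s..t}}.
     \<Sum>i<length xs - 1. ennreal \<bar>a (xs ! Suc i) - a (xs ! i)\<bar>)"

definition cadlag_path :: "(real \<Rightarrow> real) \<Rightarrow> bool" where
  "cadlag_path a \<longleftrightarrow>
     (\<forall>t\<ge>0. continuous (at_right t) a) \<and> (\<forall>t>0. \<exists>l. (a \<longlongrightarrow> l) (at_left t))"

definition fv_processes :: "'a measure \<Rightarrow> 'a process set" where
  "fv_processes M = {A. is_process M A \<and>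
     (\<forall>\<omega>\<in>space M. cadlag_path (\<lambda>t. A (\<omega>, t)) \<and>
        (\<forall>t\<ge>0. variation (\<lambda>s. A (\<omega>, s)) 0 t < \<infinity>))}"

text \<open>
  \<open>abs_stieltjes h a t\<close> is the integral of \<open>|h|\<close> over \<open>[0,t]\<close> with respect to
  \<open>|da|\<close>. The distribution function of \<open>|da|\<close> is the variation process
  \<open>s \<mapsto> |a 0| + Var(a; [0,s])\<close>, set to \<open>0\<close> for \<open>s < 0\<close>, which
  creates the mass \<open>|a 0|\<close> at \<open>0\<close>. It is frozen after \<open>t\<close>, which does not change
  the measure on \<open>[0,t]\<close>. So the integral is determined by \<open>a\<close> on \<open>[0,t]\<close> and makes
  sense for a path that is cadlag with finite variation on \<open>[0,t]\<close> only, as needed for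
  processes on \<open>B\<close>.
\<close>

definition abs_stieltjes :: "(real \<Rightarrow> real) \<Rightarrow> (real \<Rightarrow> real) \<Rightarrow> real \<Rightarrow> ennreal" where
  "abs_stieltjes h a t = (\<integral>\<^sup>+ s \<in> {0..t}. ennreal \<bar>h s\<bar>
     \<partial>interval_measure (\<lambda>s. if s < 0 then 0 else \<bar>a 0\<bar> + enn2real (variation a 0 (min s t))))"

text \<open>
  Processes, and processes on \<open>B\<close>, are identified when indistinguishable, so \<open>for all \<omega>\<close> means
  outside a null set: an element of the class of finite variation processes on \<open>B\<close> has paths of
  finite variation only almost surely. Both notions are meant for integrands and integrators that
  are indistinguishable from members of the respective classes.
\<close>

definition integrable_wrt :: "'a measure \<Rightarrow> 'a process \<Rightarrow> 'a process \<Rightarrow> bool" where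
  "integrable_wrt M H A \<longleftrightarrow>
     (AE \<omega> in M. \<forall>t\<ge>0. abs_stieltjes (\<lambda>s. H (\<omega>, s)) (\<lambda>s. A (\<omega>, s)) t < \<infinity>)"

definition integrable_on_wrt ::
  "'a measure \<Rightarrow> ('a \<times> real) set \<Rightarrow> 'a process \<Rightarrow> 'a process \<Rightarrow> bool" where
  "integrable_on_wrt M B H A \<longleftrightarrow>
     (AE \<omega> in M. \<forall>t. (\<omega>, t) \<in> B \<longrightarrow>
        abs_stieltjes (\<lambda>s. H (\<omega>, s)) (\<lambda>s. A (\<omega>, s)) t < \<infinity>)"

end

theory Submission
  imports Defs
begin

text \<open>
  The integral of \<open>|h|\<close> against \<open>|da|\<close> over \<open>[0,t]\<close> depends only on the paths on \<open>[0,t]\<close>, and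
  for paths stopped at \<open>u\<close> it does not grow after \<open>u\<close>. Hence the equivalences reduce to stopping
  along a fundamental sequence of \<open>B\<close>, for (iii) cut down by the times of given coupled
  sequences for \<open>H\<close> and \<open>A\<close>.

  The substantial point is that a predictable set of interval type has a fundamental sequence.
  Let \<open>T\<close> be the debut of its complement. The part \<open>G\<close> of the graph of \<open>T\<close> that lies outside
  \<open>B\<close> is predictable. With respect to the finite measure \<open>P \<mapsto> Pr(0 < T < \<infinity>, (\<omega>, T(\<omega>)) \<in> P)\<close>, predictable
  sets are approximated from inside by zero sets of adapted continuous processes \<open>f\<close>. If the zero set
  of \<open>f\<close> lies in \<open>G\<close>, it is the graph of a time announced by the debuts of \<open>{f < 1/n}\<close>.
  By the Borel--Cantelli lemma these announcing times can be combined into a sequence that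
  announces \<open>T\<close>, almost surely, where \<open>T\<close> does not belong to \<open>B\<close>.
\<close>

section \<open>Variation and Stieltjes integrals of stopped paths\<close>

text \<open>The difficulty is that one sequence must behave in two ways: where \<open>T\<close> lies
  in \<open>B\<close> it has to reach \<open>T\<close>, and where \<open>T\<close> lies outside
  \<open>B\<close> it has to stay strictly below. Each section of \<open>G\<close> has at most one
  point, so the debut of a zero set contained in \<open>G\<close> is \<open>T\<close> or
  \<infinity>. Where it is \<open>T\<close>, the level debuts announce \<open>T\<close> strictly
  from below; where it is \<infinity>, they grow without bound, and the minimum with
  \<open>T\<close> turns them into \<open>T\<close> itself. Which alternative holds is decided
  correctly only up to small probability, so summable errors are imposed and each \<omega> outside a
  null set is decided correctly from some index on.

  A fundamental sequence must exhaust \<open>B\<close> at every \<omega>, not almost surely. On the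
  exceptional null set it is therefore replaced by an explicit sequence read off from the section;
  the usual conditions put every subset of a null set into \<open>F 0\<close>, so adaptedness
  survives. Time 0 is harmless: sections are nonempty, hence contain 0, so \<open>T\<close> is
  positive wherever it lies outside \<open>B\<close>.\<close>

lemma variation_cong:
  assumes "\<And>r. s \<le> r \<Longrightarrow> r \<le> t \<Longrightarrow> a r = b r"
  shows "variation a s t = variation b s t"
  unfolding variation_def
proof (rule SUP_cong[OF refl])
  fix xs :: "real list" assume "xs \<in> {xs. sorted xs \<and> set xs \<subseteq> {s..t}}"
  then have "i < length xs \<Longrightarrow> a (xs ! i) = b (xs ! i)" for i
    using assms nth_mem[of i xs] by (auto simp: subset_iff)
  then show "(\<Sum>i<length xs - 1. ennreal \<bar>a (xs ! Suc i) - a (xs ! i)\<bar>) =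
      (\<Sum>i<length xs - 1. ennreal \<bar>b (xs ! Suc i) - b (xs ! i)\<bar>)"
    by (intro sum.cong) auto
qed

lemma variation_mono:
  assumes "t \<le> t'"
  shows "variation a s t \<le> variation a s t'"
  unfolding variation_def using assms by (intro SUP_subset_mono) auto

text \<open>Clipping all points of a partition at \<open>u\<close> keeps the list sorted, because
  repetitions are allowed, and leaves its sum for the stopped path unchanged. Conversely the stopped
  path agrees with \<open>a\<close> up to \<open>min t u\<close>.\<close>

lemma variation_stopped:
  assumes "s \<le> u"
  shows "variation (\<lambda>r. a (min r u)) s t = variation a s (min t u)"
proof (rule antisym)
  show "variation (\<lambda>r. a (min r u)) s t \<le> variation a s (min t u)"
    unfolding variation_def
  proof (rule SUP_mono)
    fix xs :: "real list" assume xs: "xs \<in> {xs. sorted xs \<and> set xs \<subseteq> {s..t}}"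
    let ?ys = "map (\<lambda>r. min r u) xs"
    have "sorted ?ys"
      using xs by (auto simp: sorted_iff_nth_mono min_le_iff_disj)
    moreover have "set ?ys \<subseteq> {s..min t u}"
      using xs assms by (auto simp: subset_iff min_le_iff_disj)
    moreover have "(\<Sum>i<length xs - 1. ennreal \<bar>a (min (xs ! Suc i) u) - a (min (xs ! i) u)\<bar>) =
        (\<Sum>i<length ?ys - 1. ennreal \<bar>a (?ys ! Suc i) - a (?ys ! i)\<bar>)"
      by (intro sum.cong) auto
    ultimately show "\<exists>ys\<in>{ys. sorted ys \<and> set ys \<subseteq> {s..min t u}}.
        (\<Sum>i<length xs - 1. ennreal \<bar>a (min (xs ! Suc i) u) - a (min (xs ! i) u)\<bar>)
        \<le> (\<Sum>i<length ys - 1. ennreal \<bar>a (ys ! Suc i) - a (ys ! i)\<bar>)"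
      by (intro bexI[of _ ?ys]) auto
  qed
  have "variation a s (min t u) = variation (\<lambda>r. a (min r u)) s (min t u)"
    by (intro variation_cong) auto
  also have "\<dots> \<le> variation (\<lambda>r. a (min r u)) s t"
    by (intro variation_mono) auto
  finally show "variation a s (min t u) \<le> variation (\<lambda>r. a (min r u)) s t" .
qed

text \<open>
  No monotonicity or right-continuity of \<open>G\<close> is needed, because \<^const>\<open>extend_measure\<close> is the
  zero measure whenever the prescribed values do not extend to a measure.
\<close>

lemma emeasure_interval_measure_Ioc_le:
  assumes "a \<le> b"
  shows "emeasure (interval_measure G) {a<..b} \<le> ennreal (G b - G a)"
proof -
  define I where "I = {(a, b). a \<le> (b::real)}"
  define g where "g = (\<lambda>(a, b). {a<..b::real})"
  define \<mu> where "\<mu> = (\<lambda>(a, b). ennreal (G b - G a))"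
  have I: "(a, b) \<in> I" using assms by (simp add: I_def)
  have eq: "interval_measure G = extend_measure UNIV I g \<mu>"
    by (simp add: interval_measure_def I_def g_def \<mu>_def)
  have "emeasure (extend_measure UNIV I g \<mu>) (g (a, b)) \<le> \<mu> (a, b)"
  proof (cases "\<exists>\<mu>'. (\<forall>i\<in>I. \<mu>' (g i) = \<mu> i) \<and> measure_space UNIV (sigma_sets UNIV (g ` I)) \<mu>'")
    case True
    then obtain \<mu>' where \<mu>': "\<forall>i\<in>I. \<mu>' (g i) = \<mu> i"
      "measure_space UNIV (sigma_sets UNIV (g ` I)) \<mu>'" by blast
    have sets: "sets (extend_measure UNIV I g \<mu>) = sigma_sets UNIV (g ` I)"
      by (rule sets_extend_measure) auto
    have "emeasure (extend_measure UNIV I g \<mu>) (g (a, b)) = \<mu> (a, b)"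
      using \<mu>' I
      by (intro emeasure_extend_measure[where \<mu>' = \<mu>', OF refl])
         (auto simp: measure_space_def sets)
    then show ?thesis by simp
  next
    case False
    then have "extend_measure UNIV I g \<mu> = measure_of UNIV (g ` I) (\<lambda>_. 0)"
      unfolding extend_measure_def by auto
    moreover have "emeasure (measure_of UNIV (g ` I) (\<lambda>_. 0)) (g (a, b)) = 0"
      by (simp add: emeasure_sigma)
    ultimately show ?thesis by simp
  qed
  then show ?thesis by (simp add: eq g_def \<mu>_def)
qed

text \<open>Freezing the distribution function at \<open>t\<close> makes it a function of the path
  on [0,t] only. The two distribution functions are thus equal everywhere and the measures
  coincide.\<close>

lemma abs_stieltjes_cong:
  assumes "0 \<le> t"
    and "\<And>s. 0 \<le> s \<Longrightarrow> s \<le> t \<Longrightarrow> h s = h' s"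
    and "\<And>s. 0 \<le> s \<Longrightarrow> s \<le> t \<Longrightarrow> a s = a' s"
  shows "abs_stieltjes h a t = abs_stieltjes h' a' t"
proof -
  have "(\<lambda>s. if s < 0 then 0 else \<bar>a 0\<bar> + enn2real (variation a 0 (min s t))) =
      (\<lambda>s. if s < 0 then 0 else \<bar>a' 0\<bar> + enn2real (variation a' 0 (min s t)))"
    using assms by (intro ext) (auto intro!: arg_cong[where f = enn2real] variation_cong)
  then show ?thesis
    unfolding abs_stieltjes_def using assms
    by (auto intro!: nn_integral_cong simp: indicator_def)
qed

text \<open>Stopping the path at \<open>u\<close> and freezing at \<open>t\<close> gives the same
  distribution function \<open>G\<close> as freezing at \<open>u\<close>. It is constant on [u,t],
  so ]u,t] carries no mass, and on [0,u] the integrands agree.\<close>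

lemma abs_stieltjes_stopped:
  assumes "0 \<le> u" "u \<le> t"
  shows "abs_stieltjes (\<lambda>s. h (min s u)) (\<lambda>s. a (min s u)) t = abs_stieltjes h a u"
proof -
  define G where "G s = (if s < 0 then 0 else \<bar>a 0\<bar> + enn2real (variation a 0 (min s u)))" for s
  have G: "(\<lambda>s. if s < 0 then 0 else \<bar>a (min 0 u)\<bar> +
      enn2real (variation (\<lambda>s. a (min s u)) 0 (min s t))) = G"
    using assms by (intro ext) (auto simp: G_def variation_stopped min.assoc min_absorb2)
  have sets: "sets (interval_measure G) = sets borel"
    by simp
  have "emeasure (interval_measure G) {u<..t} \<le> ennreal (G t - G u)"
    using assms by (intro emeasure_interval_measure_Ioc_le)
  also have "G t - G u = 0"
    using assms by (simp add: G_def)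
  finally have "{u<..t} \<in> null_sets (interval_measure G)"
    by (auto simp: null_sets_def)
  then have "AE s in interval_measure G. s \<notin> {u<..t}"
    by (rule AE_not_in)
  then have "(\<integral>\<^sup>+ s \<in> {0..t}. ennreal \<bar>h (min s u)\<bar> \<partial>interval_measure G) =
      (\<integral>\<^sup>+ s \<in> {0..u}. ennreal \<bar>h s\<bar> \<partial>interval_measure G)"
    using assms by (intro nn_integral_cong_AE) (auto elim!: eventually_mono simp: indicator_def)
  then show ?thesis
    unfolding abs_stieltjes_def G by (simp add: G_def[abs_def])
qed

section \<open>Stopping times and predictable sets\<close>

text \<open>The time \<open>r\<close> is approximated by \<open>q n\<close>, the right end of the
  cell of mesh 1/(n+1) containing it. Each \<open>q n\<close> has countably many values, which gives
  measurability, and lies strictly above \<open>r\<close>, as convergence along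
  \<open>at_right\<close> demands.\<close>

lemma borel_measurable_right_continuous_at_time:
  fixes X :: "'a \<times> real \<Rightarrow> real"
  assumes X: "\<And>s. 0 \<le> s \<Longrightarrow> (\<lambda>\<omega>. X (\<omega>, s)) \<in> borel_measurable M"
    and cont: "\<And>\<omega> s. \<omega> \<in> space M \<Longrightarrow> 0 \<le> s \<Longrightarrow> continuous (at_right s) (\<lambda>s. X (\<omega>, s))"
    and r [measurable]: "r \<in> borel_measurable M"
    and r0: "\<And>\<omega>. \<omega> \<in> space M \<Longrightarrow> 0 \<le> r \<omega>"
  shows "(\<lambda>\<omega>. X (\<omega>, r \<omega>)) \<in> borel_measurable M"
proof -
  define i where "i n \<omega> = nat \<lfloor>real (Suc n) * r \<omega>\<rfloor>" for n \<omega>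
  define q where "q n \<omega> = (real (i n \<omega>) + 1) / real (Suc n)" for n \<omega>
  have i [measurable]: "i n \<in> measurable M (count_space UNIV)" for n
    unfolding i_def by measurable
  show ?thesis
  proof (rule borel_measurable_LIMSEQ_real)
    fix \<omega> assume \<omega>: "\<omega> \<in> space M"
    have i_le: "real (i n \<omega>) \<le> real (Suc n) * r \<omega>" "real (Suc n) * r \<omega> < real (i n \<omega>) + 1" for n
      using r0[OF \<omega>] unfolding i_def by (simp_all add: of_nat_nat)
    have q_gt: "r \<omega> < q n \<omega>" for n
      using i_le(2)[of n] by (simp add: q_def field_simps)
    have q_le: "q n \<omega> \<le> r \<omega> + 1 / real (Suc n)" for n
    proof -
      have "real (i n \<omega>) / real (Suc n) \<le> r \<omega>"
        using i_le(1)[of n] by (simp add: pos_divide_le_eq mult.commute del: of_nat_Suc)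
      then show ?thesis by (simp add: q_def add_divide_distrib del: of_nat_Suc)
    qed
    have "(\<lambda>n. r \<omega> + 1 / real (Suc n)) \<longlonglongrightarrow> r \<omega> + 0"
      by (intro tendsto_add tendsto_const LIMSEQ_Suc lim_1_over_n)
    then have "(\<lambda>n. q n \<omega>) \<longlonglongrightarrow> r \<omega>"
      using q_gt q_le
      by (intro tendsto_sandwich[of "\<lambda>_. r \<omega>" "\<lambda>n. q n \<omega>" sequentially "\<lambda>n. r \<omega> + 1 / real (Suc n)"])
         (auto intro!: always_eventually less_imp_le)
    moreover have "q n \<omega> \<noteq> r \<omega>" for n
      using q_gt[of n] by simp
    ultimately have "filterlim (\<lambda>n. q n \<omega>) (at_right (r \<omega>)) sequentially"
      using q_gt by (auto simp: filterlim_at intro!: always_eventually)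
    moreover have "((\<lambda>s. X (\<omega>, s)) \<longlongrightarrow> X (\<omega>, r \<omega>)) (at_right (r \<omega>))"
      using cont[OF \<omega> r0[OF \<omega>]] by (simp add: continuous_within)
    ultimately show "(\<lambda>n. X (\<omega>, q n \<omega>)) \<longlonglongrightarrow> X (\<omega>, r \<omega>)"
      by (rule filterlim_compose[rotated])
  next
    fix n
    have "(\<lambda>\<omega>. (\<lambda>j \<omega>. X (\<omega>, (real j + 1) / real (Suc n))) (i n \<omega>) \<omega>) \<in> borel_measurable M"
      by (rule measurable_compose_countable) (auto intro!: X)
    then show "(\<lambda>\<omega>. X (\<omega>, q n \<omega>)) \<in> borel_measurable M"
      by (simp add: q_def)
  qed
qed

text \<open>The sets \<open>A n\<close> need not decrease, but their tail unions do, with empty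
  intersection, and continuity from above applies to these.\<close>

lemma (in finite_measure) measure_tendsto_0_of_eventually_notin:
  assumes A [measurable]: "\<And>n. A n \<in> sets M"
    and ev: "\<And>x. x \<in> space M \<Longrightarrow> \<forall>\<^sub>F n in sequentially. x \<notin> A n"
  shows "(\<lambda>n. measure M (A n)) \<longlonglongrightarrow> 0"
proof -
  define B where "B n = (\<Union>m\<in>{n..}. A m)" for n :: nat
  have B [measurable]: "B n \<in> sets M" for n
    unfolding B_def by measurable
  have "decseq B"
    by (fastforce simp: decseq_def B_def)
  moreover have "(\<Inter>n. B n) = {}"
  proof -
    have False if "x \<in> (\<Inter>n. B n)" for x
    proof -
      have "x \<in> space M"
        using that B[THEN sets.sets_into_space] by auto
      from ev[OF this] that show False
        unfolding eventually_sequentially B_def by fastforce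
    qed
    then show ?thesis by auto
  qed
  ultimately have lim: "(\<lambda>n. measure M (B n)) \<longlonglongrightarrow> 0"
    using finite_Lim_measure_decseq[of B] by (auto simp: image_subset_iff)
  show ?thesis
    by (rule tendsto_sandwich[OF _ _ tendsto_const lim])
       (auto intro!: always_eventually finite_measure_mono simp: B_def)
qed

lemma exists_Rats_between:
  fixes x :: ennreal
  assumes "x < ennreal u"
  shows "\<exists>q\<in>\<rat>. 0 \<le> q \<and> x < ennreal q \<and> q < u"
proof -
  obtain r where r: "x = ennreal r" "0 \<le> r"
    using assms by (cases x) auto
  with assms have "r < u"
    by (simp add: ennreal_less_iff)
  then obtain q where "q \<in> \<rat>" "r < q" "q < u"
    using Rats_dense_in_real by blast
  then show ?thesis
    using r by (intro bexI[of _ q]) (auto simp: ennreal_less_iff)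
qed

context usual_filtered_space
begin

section \<open>Stopping times of a right-continuous filtration\<close>

lemma space_F [simp]: "0 \<le> t \<Longrightarrow> space (F t) = space M"
  using F_subalgebra[of t] by (simp add: subalgebra_def)

lemma sets_F_subset: "0 \<le> t \<Longrightarrow> sets (F t) \<subseteq> sets M"
  using F_subalgebra[of t] by (simp add: subalgebra_def)

lemma borel_measurable_F_mono:
  assumes "f \<in> borel_measurable (F s)" "0 \<le> s" "s \<le> t"
  shows "f \<in> borel_measurable (F t)"
  using assms F_mono[of s t] by (auto simp: measurable_def)

lemma borel_measurable_F_imp:
  assumes "f \<in> borel_measurable (F t)" "0 \<le> t"
  shows "f \<in> borel_measurable M"
  using assms sets_F_subset[of t] by (auto simp: measurable_def)

text \<open>For every u > t, {T \<le> t} is the intersection of the events {T < v n} with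
  \<open>v n\<close> decreasing to \<open>t\<close> inside ]t,u], hence lies in \<open>F u\<close>.
  Right-continuity of the filtration brings it down to \<open>F t\<close>.\<close>

lemma stopping_time_lessI:
  assumes T: "\<And>u. 0 < u \<Longrightarrow> {\<omega> \<in> space M. T \<omega> < ennreal u} \<in> sets (F u)"
  shows "is_stopping_time M F T"
  unfolding is_stopping_time_def
proof (intro allI impI)
  fix t :: real assume t: "0 \<le> t"
  have "{\<omega> \<in> space M. T \<omega> \<le> ennreal t} \<in> sets (F u)" if u: "t < u" for u
  proof -
    define v where "v n = t + (u - t) / real (Suc n)" for n
    have v: "t < v n" "v n \<le> u" for n
    proof -
      show "t < v n" using u by (simp add: v_def)
      have "(u - t) / real (Suc n) \<le> (u - t) / 1"
        using u by (intro divide_left_mono) auto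
      then show "v n \<le> u" by (simp add: v_def)
    qed
    have "v \<longlonglongrightarrow> t + (u - t) * 0"
      unfolding v_def divide_inverse
      by (intro tendsto_intros LIMSEQ_inverse_real_of_nat)
    then have lim: "v \<longlonglongrightarrow> t" by simp
    have "T \<omega> \<le> ennreal t \<longleftrightarrow> (\<forall>n. T \<omega> < ennreal (v n))" for \<omega>
    proof
      assume "T \<omega> \<le> ennreal t"
      then show "\<forall>n. T \<omega> < ennreal (v n)"
        using v t by (auto intro: le_less_trans simp: ennreal_less_iff)
    next
      assume *: "\<forall>n. T \<omega> < ennreal (v n)"
      have "(\<lambda>n. ennreal (v n)) \<longlonglongrightarrow> ennreal t"
        using lim by (rule tendsto_ennrealI)
      then show "T \<omega> \<le> ennreal t"
        by (rule LIMSEQ_le_const) (use * in \<open>auto intro: less_imp_le\<close>)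
    qed
    then have "{\<omega> \<in> space M. T \<omega> \<le> ennreal t} = (\<Inter>n. {\<omega> \<in> space M. T \<omega> < ennreal (v n)})"
      by auto
    moreover have "{\<omega> \<in> space M. T \<omega> < ennreal (v n)} \<in> sets (F u)" for n
      using T[of "v n"] F_mono[of "v n" u] v[of n] t by auto
    ultimately show ?thesis by auto
  qed
  then show "{\<omega> \<in> space M. T \<omega> \<le> ennreal t} \<in> sets (F t)"
    unfolding F_right_continuous[OF t] by auto
qed

lemma stopping_time_lessD:
  assumes T: "is_stopping_time M F T" and u: "0 \<le> u"
  shows "{\<omega> \<in> space M. T \<omega> < ennreal u} \<in> sets (F u)"
proof -
  have "{\<omega> \<in> space M. T \<omega> < ennreal u} =
      (\<Union>q\<in>{q\<in>\<rat>. 0 \<le> q \<and> q < u}. {\<omega> \<in> space M. T \<omega> \<le> ennreal q})"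
    using exists_Rats_between by (fastforce intro: le_less_trans simp: ennreal_less_iff)
  also have "\<dots> \<in> sets (F u)"
  proof (rule sets.countable_UN'')
    show "countable {q\<in>\<rat>. 0 \<le> q \<and> q < u}"
      by (rule countable_subset[OF _ countable_rat]) auto
    show "{\<omega> \<in> space M. T \<omega> \<le> ennreal q} \<in> sets (F u)" if "q \<in> {q\<in>\<rat>. 0 \<le> q \<and> q < u}" for q
      using that T F_mono[of q u] by (auto simp: is_stopping_time_def)
  qed
  finally show ?thesis .
qed

text \<open>An infimum need not be attained, so only the strict events {... < u} split into unions;
  \<open>stopping_time_lessI\<close> is what makes the strict form sufficient.\<close>

lemma stopping_time_INF:
  assumes "countable I" "\<And>i. i \<in> I \<Longrightarrow> is_stopping_time M F (T i)"
  shows "is_stopping_time M F (\<lambda>\<omega>. INF i\<in>I. T i \<omega>)"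
proof (rule stopping_time_lessI)
  fix u :: real assume u: "0 < u"
  have "{\<omega> \<in> space M. (INF i\<in>I. T i \<omega>) < ennreal u} =
      (\<Union>i\<in>I. {\<omega> \<in> space M. T i \<omega> < ennreal u})"
    by (auto simp: INF_less_iff)
  also have "\<dots> \<in> sets (F u)"
    using assms u by (intro sets.countable_UN'' stopping_time_lessD) auto
  finally show "{\<omega> \<in> space M. (INF i\<in>I. T i \<omega>) < ennreal u} \<in> sets (F u)" .
qed

lemma stopping_time_min:
  assumes "is_stopping_time M F S" "is_stopping_time M F T"
  shows "is_stopping_time M F (\<lambda>\<omega>. min (S \<omega>) (T \<omega>))"
  unfolding is_stopping_time_def
proof (intro allI impI)
  fix t :: real assume "0 \<le> t"
  moreover have "{\<omega> \<in> space M. min (S \<omega>) (T \<omega>) \<le> ennreal t} =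
      {\<omega> \<in> space M. S \<omega> \<le> ennreal t} \<union> {\<omega> \<in> space M. T \<omega> \<le> ennreal t}"
    by (auto simp: min_le_iff_disj)
  ultimately show "{\<omega> \<in> space M. min (S \<omega>) (T \<omega>) \<le> ennreal t} \<in> sets (F t)"
    using assms by (auto simp: is_stopping_time_def)
qed

lemma stopping_time_borel_measurable:
  assumes "is_stopping_time M F T"
  shows "T \<in> borel_measurable M"
proof (rule borel_measurableI_less)
  fix y :: ennreal
  show "{\<omega> \<in> space M. T \<omega> < y} \<in> sets M"
  proof (cases y)
    case (real u)
    then show ?thesis
      using stopping_time_lessD[OF assms, of u] sets_F_subset[of u] by auto
  next
    case top
    have "T \<omega> < \<top> \<longleftrightarrow> (\<exists>n::nat. T \<omega> < ennreal (real n))" for \<omega>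
    proof
      assume "T \<omega> < \<top>"
      then obtain r where "T \<omega> = ennreal r" "0 \<le> r"
        by (cases "T \<omega>") auto
      moreover obtain n where "r < real n"
        using reals_Archimedean2 by blast
      ultimately show "\<exists>n::nat. T \<omega> < ennreal (real n)"
        by (auto simp: ennreal_less_iff)
    qed (auto intro: less_trans)
    then have "{\<omega> \<in> space M. T \<omega> < \<top>} = (\<Union>n::nat. {\<omega> \<in> space M. T \<omega> < ennreal (real n)})"
      by auto
    moreover have "{\<omega> \<in> space M. T \<omega> < ennreal (real n)} \<in> sets M" for n
      using stopping_time_lessD[OF assms, of "real n"] sets_F_subset[of "real n"] by auto
    ultimately have "{\<omega> \<in> space M. T \<omega> < \<top>} \<in> sets M"
      by auto
    then show ?thesis
      by (simp add: top)
  qed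
qed

section \<open>The predictable \<sigma>-algebra and adapted continuous processes\<close>

abbreviation "pred_gens \<equiv> {C \<times> {0} | C. C \<in> sets (F 0)} \<union>
    {C \<times> {s<..t} | C s t. 0 \<le> (s::real) \<and> s < t \<and> C \<in> sets (F s)}"

lemma sets_predictable: "sets (predictable_sigma M F) = sigma_sets (space M \<times> {0..}) pred_gens"
proof -
  have "C \<subseteq> space M" if "C \<in> sets (F s)" "0 \<le> s" for C s
    using sets.sets_into_space[OF that(1)] that(2) by simp
  then have "pred_gens \<subseteq> Pow (space M \<times> {0..})"
    by fastforce
  then show ?thesis
    unfolding predictable_sigma_def by (rule sets_measure_of)
qed

lemma space_predictable: "space (predictable_sigma M F) = space M \<times> {0..}"
  unfolding predictable_sigma_def by (rule space_measure_of_conv)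

lemma predictable_section:
  assumes P: "P \<in> sets (predictable_sigma M F)" and s: "0 \<le> s"
  shows "{\<omega> \<in> space M. (\<omega>, s) \<in> P} \<in> sets (F s)"
  using P unfolding sets_predictable
proof induction
  case (Basic P)
  then consider C where "P = C \<times> {0}" "C \<in> sets (F 0)"
    | C a b where "P = C \<times> {a<..b}" "0 \<le> a" "C \<in> sets (F a)" by blast
  then show ?case
  proof cases
    case 1
    then have "{\<omega> \<in> space M. (\<omega>, s) \<in> P} = (if s = 0 then C else {})"
      using sets.sets_into_space[OF 1(2)] by auto
    then show ?thesis using 1 by auto
  next
    case 2
    then have "{\<omega> \<in> space M. (\<omega>, s) \<in> P} = (if a < s \<and> s \<le> b then C else {})"
      using sets.sets_into_space[OF 2(3)] by auto
    then show ?thesis using 2 F_mono[of a s] by auto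
  qed
next
  case (Compl P)
  have "{\<omega> \<in> space M. (\<omega>, s) \<in> space M \<times> {0..} - P} =
      space (F s) - {\<omega> \<in> space M. (\<omega>, s) \<in> P}"
    using s by auto
  then show ?case using Compl by auto
next
  case (Union P)
  have "{\<omega> \<in> space M. (\<omega>, s) \<in> (\<Union>i. P i)} = (\<Union>i. {\<omega> \<in> space M. (\<omega>, s) \<in> P i})"
    by auto
  then show ?case using Union by auto
qed auto

text \<open>The values are confined to [0,1] so that products and weighted series stay in the class.
  The bound is imposed at all points \<open>p\<close>, also outside the domain, which spares side
  conditions when series are formed.\<close>

definition adapted_cont :: "('a \<times> real \<Rightarrow> real) \<Rightarrow> bool" where
  "adapted_cont f \<longleftrightarrow>
     (\<forall>s\<ge>0. (\<lambda>\<omega>. f (\<omega>, s)) \<in> borel_measurable (F s)) \<and>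
     (\<forall>\<omega>\<in>space M. continuous_on {0..} (\<lambda>s. f (\<omega>, s))) \<and>
     (\<forall>p. 0 \<le> f p \<and> f p \<le> 1)"

lemma adapted_cont_prod:
  fixes f :: "nat \<Rightarrow> 'a \<times> real \<Rightarrow> real"
  assumes "\<And>i. adapted_cont (f i)"
  shows "adapted_cont (\<lambda>p. \<Prod>i<n. f i p)"
  using assms unfolding adapted_cont_def
  by (auto intro!: borel_measurable_prod continuous_on_prod prod_nonneg prod_le_1)

text \<open>The weights are positive with sum 1: the bound by 1 is kept, the Weierstrass test gives
  continuity, and a sum of nonnegative terms vanishes only if every term does. The zero set of the
  sum is thus the intersection of the zero sets.\<close>

lemma adapted_cont_suminf:
  assumes f: "\<And>i. adapted_cont (f i)"
  shows "adapted_cont (\<lambda>p. \<Sum>i. (1/2) ^ Suc i * f i p)"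
    and "(\<Sum>i. (1/2) ^ Suc i * f i p) = 0 \<longleftrightarrow> (\<forall>i. f i p = 0)"
proof -
  have f01: "0 \<le> f i p" "f i p \<le> 1" for i p
    using f unfolding adapted_cont_def by blast+
  have bound: "norm ((1/2) ^ Suc i * f i p) \<le> (1/2) ^ Suc i" for i p
    using f01[of i p] by (simp add: abs_mult)
  have half: "(\<lambda>i. (1/2::real) ^ Suc i) sums 1"
    by (rule power_half_series)
  have summ: "summable (\<lambda>i. (1/2) ^ Suc i * f i p)" for p
    by (rule summable_comparison_test'[OF sums_summable[OF half], of 0]) (rule bound)
  show "(\<Sum>i. (1/2) ^ Suc i * f i p) = 0 \<longleftrightarrow> (\<forall>i. f i p = 0)"
    using f01 by (subst suminf_eq_zero_iff[OF summ]) auto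
  show "adapted_cont (\<lambda>p. \<Sum>i. (1/2) ^ Suc i * f i p)"
    unfolding adapted_cont_def
  proof (intro conjI allI impI ballI)
    fix s :: real assume "0 \<le> s"
    then have "(\<lambda>\<omega>. f i (\<omega>, s)) \<in> borel_measurable (F s)" for i
      using f by (auto simp: adapted_cont_def)
    then show "(\<lambda>\<omega>. \<Sum>i. (1/2) ^ Suc i * f i (\<omega>, s)) \<in> borel_measurable (F s)"
      by (intro borel_measurable_suminf borel_measurable_times) auto
  next
    fix \<omega> assume \<omega>: "\<omega> \<in> space M"
    have lim: "uniform_limit {0..} (\<lambda>n s. \<Sum>i<n. (1/2) ^ Suc i * f i (\<omega>, s))
        (\<lambda>s. \<Sum>i. (1/2) ^ Suc i * f i (\<omega>, s)) sequentially"
      using bound sums_summable[OF half] by (rule Weierstrass_m_test)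
    show "continuous_on {0..} (\<lambda>s. \<Sum>i. (1/2) ^ Suc i * f i (\<omega>, s))"
      by (rule uniform_limit_theorem[OF _ lim])
         (use f \<omega> in \<open>auto intro!: always_eventually continuous_intros simp: adapted_cont_def\<close>)
  next
    fix p
    show "0 \<le> (\<Sum>i. (1/2) ^ Suc i * f i p)"
      using f01 by (intro suminf_nonneg summ) auto
    have "(\<Sum>i. (1/2) ^ Suc i * f i p) \<le> (\<Sum>i. (1/2) ^ Suc i)"
      using f01 by (intro suminf_le summ sums_summable[OF half]) (simp add: mult_left_le)
    then show "(\<Sum>i. (1/2) ^ Suc i * f i p) \<le> 1"
      using half by (simp add: sums_iff)
  qed
qed

lemma adapted_cont_at_time:
  assumes f: "adapted_cont f" and r: "r \<in> borel_measurable M"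
    and r0: "\<And>\<omega>. \<omega> \<in> space M \<Longrightarrow> 0 \<le> r \<omega>"
  shows "(\<lambda>\<omega>. f (\<omega>, r \<omega>)) \<in> borel_measurable M"
proof (rule borel_measurable_right_continuous_at_time[OF _ _ r r0])
  show "(\<lambda>\<omega>. f (\<omega>, s)) \<in> borel_measurable M" if "0 \<le> s" for s
    using f that by (auto simp: adapted_cont_def intro: borel_measurable_F_imp)
  fix \<omega> s assume "\<omega> \<in> space M" "0 \<le> (s::real)"
  then have "continuous (at s within {0..}) (\<lambda>s. f (\<omega>, s))"
    using f by (auto simp: adapted_cont_def continuous_on_eq_continuous_within)
  then show "continuous (at_right s) (\<lambda>s. f (\<omega>, s))"
    by (rule continuous_within_subset) (use \<open>0 \<le> s\<close> in auto)
qed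

end

section \<open>Inner approximation of predictable sets by zero sets\<close>

context usual_filtered_space
begin

text \<open>Intended for \<open>r = enn2real T\<close>. The value 0 of \<open>r\<close> then stands
  for T = 0 as well as for T = \<infinity>, so the condition \<open>0 < r \<omega>\<close> singles
  out 0 < T < \<infinity>.\<close>

definition graph_event :: "('a \<Rightarrow> real) \<Rightarrow> ('a \<times> real) set \<Rightarrow> 'a set" where
  "graph_event r P = {\<omega> \<in> space M. 0 < r \<omega> \<and> (\<omega>, r \<omega>) \<in> P}"

lemma graph_event_measurable:
  assumes P: "P \<in> sets (predictable_sigma M F)" and r [measurable]: "r \<in> borel_measurable M"
  shows "graph_event r P \<in> sets M"
  using P unfolding sets_predictable
proof induction
  case (Basic P)
  then consider C where "P = C \<times> {0}" "C \<in> sets (F 0)"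
    | C a b where "P = C \<times> {a<..b}" "0 \<le> a" "C \<in> sets (F a)" by blast
  then show ?case
  proof cases
    case 1
    then have "graph_event r P = {}" by (auto simp: graph_event_def)
    then show ?thesis by simp
  next
    case 2
    then have [measurable]: "C \<in> sets M" using sets_F_subset[of a] by auto
    have "graph_event r P = {\<omega> \<in> space M. 0 < r \<omega> \<and> \<omega> \<in> C \<and> a < r \<omega> \<and> r \<omega> \<le> b}"
      using 2 by (auto simp: graph_event_def)
    also have "\<dots> \<in> sets M" by measurable
    finally show ?thesis .
  qed
next
  case (Compl P)
  have "graph_event r (space M \<times> {0..} - P) = {\<omega> \<in> space M. 0 < r \<omega>} - graph_event r P"
    by (auto simp: graph_event_def)
  also have "\<dots> \<in> sets M"
    using Compl by measurable
  finally show ?case .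
next
  case (Union P)
  have "graph_event r (\<Union>i. P i) = (\<Union>i. graph_event r (P i))"
    by (auto simp: graph_event_def)
  then show ?case using Union by auto
qed (simp add: graph_event_def)

lemma adapted_cont_nonzero_event:
  assumes f: "adapted_cont f" and r: "r \<in> borel_measurable M" "\<And>\<omega>. \<omega> \<in> space M \<Longrightarrow> 0 \<le> r \<omega>"
  shows "{\<omega> \<in> space M. f (\<omega>, r \<omega>) \<noteq> 0} \<in> sets M"
proof -
  have [measurable]: "(\<lambda>\<omega>. f (\<omega>, r \<omega>)) \<in> borel_measurable M"
    using f r by (rule adapted_cont_at_time)
  show ?thesis by measurable
qed

text \<open>Inner regularity of the measure \<open>P \<mapsto> prob (graph_event r P)\<close> with
  respect to zero sets. The inclusion of the zero set in \<open>P\<close> is required at every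
  \<omega>; only the missing part is measured by probability.\<close>

definition inner_approx :: "('a \<Rightarrow> real) \<Rightarrow> ('a \<times> real) set \<Rightarrow> bool" where
  "inner_approx r P \<longleftrightarrow> (\<forall>\<epsilon>>0. \<exists>f. adapted_cont f \<and>
     (\<forall>\<omega>\<in>space M. \<forall>s\<ge>0. f (\<omega>, s) = 0 \<longrightarrow> (\<omega>, s) \<in> P) \<and>
     prob (graph_event r P \<inter> {\<omega> \<in> space M. f (\<omega>, r \<omega>) \<noteq> 0}) \<le> \<epsilon>)"

text \<open>Exact vanishing of \<open>f n\<close> at time \<open>r \<omega>\<close> from some
  \<open>n\<close> on, for each \<omega> separately, forces the probabilities of the exceptional
  events to tend to 0.\<close>

lemma inner_approx_sequenceI:
  assumes P: "graph_event r P \<in> sets M"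
    and r: "r \<in> borel_measurable M" "\<And>\<omega>. \<omega> \<in> space M \<Longrightarrow> 0 \<le> r \<omega>"
    and f: "\<And>n. adapted_cont (f n)"
    and zero: "\<And>n \<omega> s. \<omega> \<in> space M \<Longrightarrow> 0 \<le> s \<Longrightarrow> f n (\<omega>, s) = 0 \<Longrightarrow> (\<omega>, s) \<in> P"
    and ev: "\<And>\<omega>. \<omega> \<in> graph_event r P \<Longrightarrow> \<forall>\<^sub>F n in sequentially. f n (\<omega>, r \<omega>) = 0"
  shows "inner_approx r P"
  unfolding inner_approx_def
proof (intro allI impI)
  fix \<epsilon> :: real assume "0 < \<epsilon>"
  have "(\<lambda>n. prob (graph_event r P \<inter> {\<omega> \<in> space M. f n (\<omega>, r \<omega>) \<noteq> 0})) \<longlonglongrightarrow> 0"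
  proof (rule measure_tendsto_0_of_eventually_notin)
    show "graph_event r P \<inter> {\<omega> \<in> space M. f n (\<omega>, r \<omega>) \<noteq> 0} \<in> sets M" for n
      using adapted_cont_nonzero_event[OF f r] P by auto
    show "\<forall>\<^sub>F n in sequentially. \<omega> \<notin> graph_event r P \<inter> {\<omega> \<in> space M. f n (\<omega>, r \<omega>) \<noteq> 0}" for \<omega>
      using ev[of \<omega>] by (cases "\<omega> \<in> graph_event r P") (auto elim: eventually_mono)
  qed
  then have "\<forall>\<^sub>F n in sequentially.
      prob (graph_event r P \<inter> {\<omega> \<in> space M. f n (\<omega>, r \<omega>) \<noteq> 0}) < \<epsilon>"
    using \<open>0 < \<epsilon>\<close> by (rule order_tendstoD)
  then obtain n where "prob (graph_event r P \<inter> {\<omega> \<in> space M. f n (\<omega>, r \<omega>) \<noteq> 0}) < \<epsilon>"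
    by (auto simp: eventually_sequentially)
  then show "\<exists>f. adapted_cont f \<and> (\<forall>\<omega>\<in>space M. \<forall>s\<ge>0. f (\<omega>, s) = 0 \<longrightarrow> (\<omega>, s) \<in> P) \<and>
      prob (graph_event r P \<inter> {\<omega> \<in> space M. f (\<omega>, r \<omega>) \<noteq> 0}) \<le> \<epsilon>"
    using f zero by (intro exI[of _ "f n"]) (auto intro: less_imp_le)
qed

text \<open>
  The zero sets of adapted continuous processes are closed under countable intersections (take
  weighted sums) and finite unions (take products); this makes the approximable sets whose
  complements are approximable a \<open>\<sigma>\<close>-algebra.
\<close>

lemma inner_approx_INT:
  assumes r: "r \<in> borel_measurable M" "\<And>\<omega>. \<omega> \<in> space M \<Longrightarrow> 0 \<le> r \<omega>"
    and meas: "\<And>i. graph_event r (P i) \<in> sets M" and P: "\<And>i::nat. inner_approx r (P i)"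
  shows "inner_approx r (\<Inter>i. P i)"
  unfolding inner_approx_def
proof (intro allI impI)
  fix \<epsilon> :: real assume \<epsilon>: "0 < \<epsilon>"
  have "\<exists>f. adapted_cont f \<and> (\<forall>\<omega>\<in>space M. \<forall>s\<ge>0. f (\<omega>, s) = 0 \<longrightarrow> (\<omega>, s) \<in> P i) \<and>
      prob (graph_event r (P i) \<inter> {\<omega> \<in> space M. f (\<omega>, r \<omega>) \<noteq> 0}) \<le> \<epsilon> * (1/2) ^ Suc i" for i
  proof -
    have "0 < \<epsilon> * (1/2) ^ Suc i" using \<epsilon> by simp
    then show ?thesis by (rule P[of i, unfolded inner_approx_def, THEN spec, THEN mp])
  qed
  from choice[OF allI[OF this]] obtain f where *: "\<forall>i. adapted_cont (f i) \<and>
      (\<forall>\<omega>\<in>space M. \<forall>s\<ge>0. f i (\<omega>, s) = 0 \<longrightarrow> (\<omega>, s) \<in> P i) \<and>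
      prob (graph_event r (P i) \<inter> {\<omega> \<in> space M. f i (\<omega>, r \<omega>) \<noteq> 0}) \<le> \<epsilon> * (1/2) ^ Suc i"
    by (rule exE)
  have f: "adapted_cont (f i)"
    "\<omega> \<in> space M \<Longrightarrow> 0 \<le> s \<Longrightarrow> f i (\<omega>, s) = 0 \<Longrightarrow> (\<omega>, s) \<in> P i"
    "prob (graph_event r (P i) \<inter> {\<omega> \<in> space M. f i (\<omega>, r \<omega>) \<noteq> 0}) \<le> \<epsilon> * (1/2) ^ Suc i"
    for i \<omega> s
    using *[rule_format, of i] by blast+
  define N where "N i = graph_event r (P i) \<inter> {\<omega> \<in> space M. f i (\<omega>, r \<omega>) \<noteq> 0}" for i
  have N: "N i \<in> sets M" for i
    unfolding N_def using adapted_cont_nonzero_event[OF f(1) r] meas by auto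
  define g where "g p = (\<Sum>i. (1/2) ^ Suc i * f i p)" for p
  have g: "adapted_cont g" "g p = 0 \<longleftrightarrow> (\<forall>i. f i p = 0)" for p
    using adapted_cont_suminf[of f, OF f(1)] by (simp_all add: g_def[abs_def])
  have sums: "(\<lambda>i. \<epsilon> * (1/2) ^ Suc i) sums \<epsilon>"
    using sums_mult[OF power_half_series, of \<epsilon>] by simp
  have summ: "summable (\<lambda>i. prob (N i))"
    by (rule summable_comparison_test'[OF sums_summable[OF sums], of 0]) (use f(3) in \<open>simp add: N_def\<close>)
  have "graph_event r (\<Inter>i. P i) \<inter> {\<omega> \<in> space M. g (\<omega>, r \<omega>) \<noteq> 0} \<subseteq> (\<Union>i. N i)"
    using g(2) by (auto simp: N_def graph_event_def)
  then have "prob (graph_event r (\<Inter>i. P i) \<inter> {\<omega> \<in> space M. g (\<omega>, r \<omega>) \<noteq> 0}) \<le> prob (\<Union>i. N i)"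
    using N by (intro finite_measure_mono) auto
  also have "\<dots> \<le> (\<Sum>i. prob (N i))"
    using N summ by (intro finite_measure_subadditive_countably) auto
  also have "\<dots> \<le> \<epsilon>"
    using f(3) sums by (subst sums_unique[OF sums]) (intro suminf_le summ sums_summable[OF sums], simp add: N_def)
  finally show "\<exists>f. adapted_cont f \<and> (\<forall>\<omega>\<in>space M. \<forall>s\<ge>0. f (\<omega>, s) = 0 \<longrightarrow> (\<omega>, s) \<in> (\<Inter>i. P i)) \<and>
      prob (graph_event r (\<Inter>i. P i) \<inter> {\<omega> \<in> space M. f (\<omega>, r \<omega>) \<noteq> 0}) \<le> \<epsilon>"
    using g f(2) by (intro exI[of _ g]) auto
qed

text \<open>A finite product reaches only finitely many members of the union. One half of \<epsilon>
  pays for \<open>D n\<close>, the part of the graph lost by truncating the union at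
  \<open>n\<close>, the other half for the errors of the approximations.\<close>

lemma inner_approx_UN:
  assumes r: "r \<in> borel_measurable M" "\<And>\<omega>. \<omega> \<in> space M \<Longrightarrow> 0 \<le> r \<omega>"
    and meas: "\<And>i. graph_event r (P i) \<in> sets M" and P: "\<And>i::nat. inner_approx r (P i)"
  shows "inner_approx r (\<Union>i. P i)"
  unfolding inner_approx_def
proof (intro allI impI)
  fix \<epsilon> :: real assume \<epsilon>: "0 < \<epsilon>"
  have "\<exists>f. adapted_cont f \<and> (\<forall>\<omega>\<in>space M. \<forall>s\<ge>0. f (\<omega>, s) = 0 \<longrightarrow> (\<omega>, s) \<in> P i) \<and>
      prob (graph_event r (P i) \<inter> {\<omega> \<in> space M. f (\<omega>, r \<omega>) \<noteq> 0}) \<le> \<epsilon> / 2 * (1/2) ^ Suc i" for i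
  proof -
    have "0 < \<epsilon> / 2 * (1/2) ^ Suc i" using \<epsilon> by simp
    then show ?thesis by (rule P[of i, unfolded inner_approx_def, THEN spec, THEN mp])
  qed
  from choice[OF allI[OF this]] obtain f where *: "\<forall>i. adapted_cont (f i) \<and>
      (\<forall>\<omega>\<in>space M. \<forall>s\<ge>0. f i (\<omega>, s) = 0 \<longrightarrow> (\<omega>, s) \<in> P i) \<and>
      prob (graph_event r (P i) \<inter> {\<omega> \<in> space M. f i (\<omega>, r \<omega>) \<noteq> 0}) \<le> \<epsilon> / 2 * (1/2) ^ Suc i"
    by (rule exE)
  have f: "adapted_cont (f i)"
    "\<omega> \<in> space M \<Longrightarrow> 0 \<le> s \<Longrightarrow> f i (\<omega>, s) = 0 \<Longrightarrow> (\<omega>, s) \<in> P i"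
    "prob (graph_event r (P i) \<inter> {\<omega> \<in> space M. f i (\<omega>, r \<omega>) \<noteq> 0}) \<le> \<epsilon> / 2 * (1/2) ^ Suc i"
    for i \<omega> s
    using *[rule_format, of i] by blast+
  define N where "N i = graph_event r (P i) \<inter> {\<omega> \<in> space M. f i (\<omega>, r \<omega>) \<noteq> 0}" for i
  have N: "N i \<in> sets M" for i
    unfolding N_def using adapted_cont_nonzero_event[OF f(1) r] meas by auto
  define D where "D n = graph_event r (\<Union>i. P i) - (\<Union>i<n. graph_event r (P i))" for n
  have "graph_event r (\<Union>i. P i) = (\<Union>i. graph_event r (P i))"
    by (auto simp: graph_event_def)
  then have D: "D n \<in> sets M" for n
    unfolding D_def using meas by auto
  have "(\<lambda>n. prob (D n)) \<longlonglongrightarrow> 0"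
  proof (rule measure_tendsto_0_of_eventually_notin[OF D])
    fix \<omega>
    show "\<forall>\<^sub>F n in sequentially. \<omega> \<notin> D n"
    proof (cases "\<omega> \<in> graph_event r (\<Union>i. P i)")
      case True
      then obtain i where "\<omega> \<in> graph_event r (P i)"
        by (auto simp: graph_event_def)
      then have "\<omega> \<notin> D n" if "n \<ge> Suc i" for n
        using that by (auto simp: D_def)
      then show ?thesis
        unfolding eventually_sequentially by blast
    qed (simp add: D_def)
  qed
  then have "\<forall>\<^sub>F n in sequentially. prob (D n) < \<epsilon> / 2"
    using \<epsilon> by (intro order_tendstoD) auto
  then obtain n where n: "prob (D n) < \<epsilon> / 2"
    by (auto simp: eventually_sequentially)
  define g where "g p = (\<Prod>i<n. f i p)" for p
  have g: "adapted_cont g"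
    unfolding g_def using f(1) by (rule adapted_cont_prod)
  have sums: "(\<lambda>i. \<epsilon> / 2 * (1/2) ^ Suc i) sums (\<epsilon> / 2)"
    using sums_mult[OF power_half_series, of "\<epsilon> / 2"] by simp
  have "graph_event r (\<Union>i. P i) \<inter> {\<omega> \<in> space M. g (\<omega>, r \<omega>) \<noteq> 0} \<subseteq> D n \<union> (\<Union>i<n. N i)"
    by (auto simp: N_def D_def graph_event_def g_def)
  then have "prob (graph_event r (\<Union>i. P i) \<inter> {\<omega> \<in> space M. g (\<omega>, r \<omega>) \<noteq> 0})
      \<le> prob (D n \<union> (\<Union>i<n. N i))"
    using N D by (intro finite_measure_mono) auto
  also have "\<dots> \<le> prob (D n) + prob (\<Union>i<n. N i)"
    using N D by (intro measure_Un_le) auto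
  also have "prob (\<Union>i<n. N i) \<le> (\<Sum>i<n. prob (N i))"
    using N by (intro finite_measure_subadditive_finite) auto
  also have "\<dots> \<le> (\<Sum>i<n. \<epsilon> / 2 * (1/2) ^ Suc i)"
    using f(3) unfolding N_def by (rule sum_mono)
  also have "\<dots> \<le> (\<Sum>i. \<epsilon> / 2 * (1/2) ^ Suc i)"
    using \<epsilon> by (intro sum_le_suminf sums_summable[OF sums]) auto
  also have "\<dots> = \<epsilon> / 2"
    using sums by (rule sums_unique[symmetric])
  finally have "prob (graph_event r (\<Union>i. P i) \<inter> {\<omega> \<in> space M. g (\<omega>, r \<omega>) \<noteq> 0}) \<le> \<epsilon>"
    using n by simp
  then show "\<exists>f. adapted_cont f \<and> (\<forall>\<omega>\<in>space M. \<forall>s\<ge>0. f (\<omega>, s) = 0 \<longrightarrow> (\<omega>, s) \<in> (\<Union>i. P i)) \<and>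
      prob (graph_event r (\<Union>i. P i) \<inter> {\<omega> \<in> space M. f (\<omega>, r \<omega>) \<noteq> 0}) \<le> \<epsilon>"
    using g f(2) by (intro exI[of _ g]) (auto simp: g_def)
qed

text \<open>Up to time \<open>a\<close> the value is \<open>c\<close> whether or not \<omega> lies
  in \<open>C\<close>, so \<open>C\<close> has to be known only after \<open>a\<close>, when
  \<open>C \<in> sets (F s)\<close>. Since \<open>h\<close> also equals \<open>c\<close> there,
  switching between the two branches breaks no continuity.\<close>

lemma adapted_cont_switch:
  assumes C: "C \<in> sets (F a)" and a: "0 \<le> a"
    and c: "c \<in> {0..1}" and h: "continuous_on UNIV h" "\<And>s. h s \<in> {0..1}"
    and hc: "\<And>s. s \<le> a \<Longrightarrow> h s = c"
  shows "adapted_cont (\<lambda>(\<omega>, s). if \<omega> \<in> C then h s else c)"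
  unfolding adapted_cont_def
proof (intro conjI allI impI ballI)
  fix s :: real assume s: "0 \<le> s"
  show "(\<lambda>\<omega>. case (\<omega>, s) of (\<omega>, s) \<Rightarrow> if \<omega> \<in> C then h s else c) \<in> borel_measurable (F s)"
  proof (cases "s \<le> a")
    case True
    have "(\<lambda>\<omega>. case (\<omega>, s) of (\<omega>, s) \<Rightarrow> if \<omega> \<in> C then h s else c) = (\<lambda>_. c)"
      using hc[OF True] by auto
    then show ?thesis by simp
  next
    case False
    then have "C \<in> sets (F s)" using C a F_mono[of a s] by auto
    then show ?thesis by simp
  qed
next
  fix \<omega>
  show "continuous_on {0..} (\<lambda>s. case (\<omega>, s) of (\<omega>, s) \<Rightarrow> if \<omega> \<in> C then h s else c)"
    using h(1) by (cases "\<omega> \<in> C") (auto intro: continuous_on_subset)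
qed (use h(2) c in \<open>auto split: prod.splits\<close>)

lemma inner_approx_generator:
  assumes r: "r \<in> borel_measurable M" "\<And>\<omega>. \<omega> \<in> space M \<Longrightarrow> 0 \<le> r \<omega>"
    and P: "P \<in> pred_gens"
  shows "inner_approx r P" "inner_approx r (space M \<times> {0..} - P)"
proof -
  have "P \<in> sets (predictable_sigma M F)"
    using P by (auto simp: sets_predictable)
  then have P': "P \<in> sets (predictable_sigma M F)"
    "space M \<times> {0..} - P \<in> sets (predictable_sigma M F)"
    using sets.compl_sets[of P "predictable_sigma M F"] by (auto simp: space_predictable)
  note meas = graph_event_measurable[OF P'(1) r(1)] graph_event_measurable[OF P'(2) r(1)]
  \<comment> \<open>\<open>up\<close> vanishes exactly for x \<le> 0 and cuts off sharply at a
    closed end. \<open>down n\<close> is 1 for x \<le> 0 and vanishes exactly from 1/(n+1) on; it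
    reaches an open end only in the limit.\<close>
  define up down :: "nat \<Rightarrow> real \<Rightarrow> real" where
    "up n x = min 1 (max 0 x)" and "down n x = max 0 (min 1 (1 - real (Suc n) * x))" for n x
  have cont: "continuous_on S (\<lambda>s. up n (s - c))" "continuous_on S (\<lambda>s. down n (s - c))" for S n c
    unfolding up_def down_def by (intro continuous_intros)+
  have bounds: "0 \<le> up n x" "up n x \<le> 1" "0 \<le> down n x" "down n x \<le> 1" for n x
    by (simp_all add: up_def down_def)
  have up0: "up n x = 0 \<longleftrightarrow> x \<le> 0" for n x
    by (auto simp: up_def)
  have down0: "down n x = 0 \<longleftrightarrow> 1 \<le> real (Suc n) * x" for n x
    by (auto simp: down_def simp del: of_nat_Suc)
  have down1: "down n x = 1" if "x \<le> 0" for n x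
  proof -
    have "real (Suc n) * x \<le> 0"
      using that by (intro mult_nonneg_nonpos) auto
    then show ?thesis by (simp add: down_def del: of_nat_Suc)
  qed
  have down0_pos: "0 < x" if "down n x = 0" for n x
    using that down1[of x n] by (cases "x \<le> 0") auto
  have ev: "\<forall>\<^sub>F n in sequentially. down n x = 0" if "0 < x" for x
  proof -
    obtain m where m: "1 / x < real m"
      using reals_Archimedean2 by blast
    have "down n x = 0" if "n \<ge> m" for n
    proof -
      have "1 / x \<le> real (Suc n)" using m that by linarith
      then show ?thesis
        using \<open>0 < x\<close> by (simp add: down0 pos_divide_le_eq del: of_nat_Suc)
    qed
    then show ?thesis unfolding eventually_sequentially by blast
  qed
  from P consider C where "P = C \<times> {0}" "C \<in> sets (F 0)"
    | C a b where "P = C \<times> {a<..b}" "0 \<le> a" "a < b" "C \<in> sets (F a)" by blast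
  then have "inner_approx r P \<and> inner_approx r (space M \<times> {0..} - P)"
  proof cases
    case 1
    \<comment> \<open>The graph event of \<open>C \<times> {0}\<close> is empty because
      \<open>r\<close> must be positive there, so the constant 1, with its empty zero set, is good
      enough.\<close>
    have "inner_approx r P"
    proof (rule inner_approx_sequenceI[OF meas(1) r, where f = "\<lambda>_ _. 1"])
      show "adapted_cont (\<lambda>_. 1)" by (simp add: adapted_cont_def)
    qed (use 1 in \<open>auto simp: graph_event_def\<close>)
    moreover have "inner_approx r (space M \<times> {0..} - P)"
    proof (rule inner_approx_sequenceI[OF meas(2) r, where f = "\<lambda>n (\<omega>, s). down n s"])
      show "adapted_cont (\<lambda>(\<omega>, s). down n s)" for n
        using cont(2)[of _ n 0] bounds by (auto simp: adapted_cont_def)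
      show "\<forall>\<^sub>F n in sequentially. (\<lambda>(\<omega>, s). down n s) (\<omega>, r \<omega>) = 0"
        if "\<omega> \<in> graph_event r (space M \<times> {0..} - P)" for \<omega>
        using ev[of "r \<omega>"] that by (simp add: graph_event_def)
      show "(\<omega>, s) \<in> space M \<times> {0..} - P"
        if "\<omega> \<in> space M" "0 \<le> s" "(\<lambda>(\<omega>, s). down n s) (\<omega>, s) = 0" for n \<omega> s
        using that down0_pos[of n s] 1 by auto
    qed
    ultimately show ?thesis by blast
  next
    case 2
    \<comment> \<open>On \<open>C\<close> the zeros of this maximum form [a + 1/(n+1), b], which
      increases to ]a,b].\<close>
    let ?h = "\<lambda>n s. max (down n (s - a)) (up n (s - b))"
    have h0: "?h n s = 0 \<longleftrightarrow> down n (s - a) = 0 \<and> s \<le> b" for n s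
      using bounds(1)[of n "s - b"] bounds(3)[of n "s - a"] up0[of n "s - b"]
      unfolding max_def by auto
    have "inner_approx r P"
    proof (rule inner_approx_sequenceI[OF meas(1) r,
          where f = "\<lambda>n (\<omega>, s). if \<omega> \<in> C then ?h n s else 1"])
      show "adapted_cont (\<lambda>(\<omega>, s). if \<omega> \<in> C then ?h n s else 1)" for n
      proof (rule adapted_cont_switch[OF 2(4,2)])
        show "?h n s = 1" if "s \<le> a" for s
          using that bounds by (simp add: down1 max_absorb1)
        show "continuous_on UNIV (?h n)"
          using cont by (rule continuous_on_max[rotated])
        show "?h n s \<in> {0..1}" for s
          using bounds by (simp add: le_max_iff_disj)
      qed simp
      show "(\<omega>, s) \<in> P"
        if "(\<lambda>(\<omega>, s). if \<omega> \<in> C then ?h n s else 1) (\<omega>, s) = 0" for n \<omega> s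
      proof -
        have "\<omega> \<in> C" "?h n s = 0"
          using that by (cases "\<omega> \<in> C"; simp)+
        then show ?thesis
          using down0_pos[of n "s - a"] 2(1) unfolding h0 by auto
      qed
      show "\<forall>\<^sub>F n in sequentially. (\<lambda>(\<omega>, s). if \<omega> \<in> C then ?h n s else 1) (\<omega>, r \<omega>) = 0"
        if "\<omega> \<in> graph_event r P" for \<omega>
      proof -
        have "\<omega> \<in> C" "a < r \<omega>" "r \<omega> \<le> b"
          using that 2(1) by (auto simp: graph_event_def)
        then show ?thesis
          using ev[of "r \<omega> - a"] by (simp add: h0)
      qed
    qed
    moreover
    \<comment> \<open>On \<open>C\<close> this minimum vanishes for s \<le> a and for s \<ge> b +
      1/(n+1), closed sets that increase to the complement of ]a,b]. Off \<open>C\<close> the value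
      0 is right at all times.\<close>
    let ?k = "\<lambda>n s. min (down n (s - b)) (up n (s - a))"
    have k0: "?k n s = 0 \<longleftrightarrow> down n (s - b) = 0 \<or> s \<le> a" for n s
      using bounds(1)[of n "s - a"] bounds(3)[of n "s - b"] up0[of n "s - a"]
      unfolding min_def by auto
    have "inner_approx r (space M \<times> {0..} - P)"
    proof (rule inner_approx_sequenceI[OF meas(2) r,
          where f = "\<lambda>n (\<omega>, s). if \<omega> \<in> C then ?k n s else 0"])
      show "adapted_cont (\<lambda>(\<omega>, s). if \<omega> \<in> C then ?k n s else 0)" for n
      proof (rule adapted_cont_switch[OF 2(4,2)])
        show "?k n s = 0" if "s \<le> a" for s
          using that by (simp only: k0) simp
        show "continuous_on UNIV (?k n)"
          using cont by (rule continuous_on_min[rotated])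
        show "?k n s \<in> {0..1}" for s
          using bounds by (simp add: min_le_iff_disj)
      qed simp
      show "(\<omega>, s) \<in> space M \<times> {0..} - P"
        if "\<omega> \<in> space M" "0 \<le> s" "(\<lambda>(\<omega>, s). if \<omega> \<in> C then ?k n s else 0) (\<omega>, s) = 0" for n \<omega> s
      proof (cases "\<omega> \<in> C")
        case True
        then have "?k n s = 0" using that(3) by simp
        then show ?thesis
          using down0_pos[of n "s - b"] that 2(1) unfolding k0 by auto
      qed (use that 2(1) in auto)
      show "\<forall>\<^sub>F n in sequentially. (\<lambda>(\<omega>, s). if \<omega> \<in> C then ?k n s else 0) (\<omega>, r \<omega>) = 0"
        if "\<omega> \<in> graph_event r (space M \<times> {0..} - P)" for \<omega>
      proof (cases "\<omega> \<in> C \<and> b < r \<omega>")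
        case True
        then show ?thesis
          using ev[of "r \<omega> - b"] by (simp add: k0 eventually_mono)
      next
        case False
        then have "\<omega> \<notin> C \<or> r \<omega> \<le> a"
          using that 2(1) by (auto simp: graph_event_def)
        then show ?thesis
          by (auto simp: k0)
      qed
    qed
    ultimately show ?thesis by blast
  qed
  then show "inner_approx r P" "inner_approx r (space M \<times> {0..} - P)" by auto
qed

lemma predictable_inner_approx:
  assumes r: "r \<in> borel_measurable M" "\<And>\<omega>. \<omega> \<in> space M \<Longrightarrow> 0 \<le> r \<omega>"
    and P: "P \<in> sets (predictable_sigma M F)"
  shows "inner_approx r P"
proof -
  have "inner_approx r P \<and> inner_approx r (space M \<times> {0..} - P)"
    using P unfolding sets_predictable
  proof induction
    case (Basic P)
    then show ?case by (intro conjI inner_approx_generator[OF r])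
  next
    case Empty
    have "adapted_cont (\<lambda>_. 0)" "adapted_cont (\<lambda>_. 1)" by (simp_all add: adapted_cont_def)
    then have "inner_approx r {}" "inner_approx r (space M \<times> {0..})"
      unfolding inner_approx_def graph_event_def
      by (simp_all add: exI[of _ "\<lambda>_. 1"] exI[of _ "\<lambda>_. 0"])
    then show ?case by simp
  next
    case (Compl P)
    then have "P \<subseteq> space M \<times> {0..}"
      using sets.sets_into_space[of P "predictable_sigma M F"]
      by (simp add: sets_predictable space_predictable)
    then show ?case using Compl by (simp add: double_diff)
  next
    case (Union P)
    have P: "P i \<in> sets (predictable_sigma M F)" for i
      using Union by (simp add: sets_predictable)
    then have "space M \<times> {0..} - P i \<in> sets (predictable_sigma M F)" for i
      using sets.compl_sets[of "P i" "predictable_sigma M F"] by (auto simp: space_predictable)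
    then have "inner_approx r (\<Inter>i. space M \<times> {0..} - P i)"
      using Union by (intro inner_approx_INT r graph_event_measurable) auto
    moreover have "(\<Inter>i. space M \<times> {0..} - P i) = space M \<times> {0..} - (\<Union>i. P i)" by auto
    moreover have "inner_approx r (\<Union>i. P i)"
      using Union P by (intro inner_approx_UN r graph_event_measurable) auto
    ultimately show ?case by simp
  qed
  then show ?thesis by blast
qed

end

section \<open>Announcing sequences\<close>

text \<open>Announces the first zero of \<phi>. The strict inequality makes the level set relatively
  open for continuous \<phi>, so its debut can be tested at rational times; the cap
  \<open>of_nat n\<close> keeps the times finite and disappears in the limit.\<close>

definition level_debut :: "(real \<Rightarrow> real) \<Rightarrow> nat \<Rightarrow> ennreal" where
  "level_debut \<phi> n = min (of_nat n) (Inf {ennreal s | s. 0 \<le> s \<and> \<phi> s < 1 / real (Suc n)})"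

lemma incseq_level_debut: "incseq (level_debut \<phi>)"
proof (rule incseq_SucI)
  fix n
  have "1 / real (Suc (Suc n)) \<le> 1 / real (Suc n)"
    by (intro divide_left_mono) auto
  then have "{ennreal s | s. 0 \<le> s \<and> \<phi> s < 1 / real (Suc (Suc n))}
      \<subseteq> {ennreal s | s. 0 \<le> s \<and> \<phi> s < 1 / real (Suc n)}"
    by fastforce
  then show "level_debut \<phi> n \<le> level_debut \<phi> (Suc n)"
    unfolding level_debut_def by (intro min.mono Inf_superset_mono) auto
qed

text \<open>By continuity \<phi> is already below the level slightly before the zero
  \<open>z\<close>, and z > 0 leaves room for such a time. This strictness keeps the announcing
  times below a \<open>T\<close> outside \<open>B\<close>.\<close>

lemma level_debut_less_zero:
  assumes cont: "continuous_on {0..} \<phi>" and z: "\<phi> z = 0" "0 < z"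
  shows "level_debut \<phi> n < ennreal z"
proof -
  have "(\<phi> \<longlongrightarrow> \<phi> z) (at z within {0..})"
    using cont z(2) by (simp add: continuous_on_def)
  then have "(\<phi> \<longlongrightarrow> 0) (at z)"
    using z(2) at_within_interior[of z "{0..}"] unfolding z(1) by simp
  then have "\<forall>\<^sub>F s in at z. \<phi> s < 1 / real (Suc n)"
    by (rule order_tendstoD) simp
  then have "\<forall>\<^sub>F s in at_left z. \<phi> s < 1 / real (Suc n)"
    by (rule filter_leD[OF at_le, rotated]) simp
  moreover have "\<forall>\<^sub>F s in at_left z. s \<in> {0<..<z}"
    using z(2) by (rule eventually_at_left_real)
  ultimately have "\<forall>\<^sub>F s in at_left z. \<phi> s < 1 / real (Suc n) \<and> s \<in> {0<..<z}"
    by (rule eventually_conj)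
  then obtain s where s: "\<phi> s < 1 / real (Suc n)" "0 < s" "s < z"
    using eventually_happens'[OF trivial_limit_at_left_real] by auto
  have "level_debut \<phi> n \<le> ennreal s"
    unfolding level_debut_def using s by (intro min.coboundedI2 Inf_lower) auto
  also have "\<dots> < ennreal z"
    using s by (simp add: ennreal_less_iff)
  finally show ?thesis .
qed

text \<open>Compactness: if all level debuts stay below a real \<open>u\<close>, then for n > u the
  cap is inactive and \<phi> falls below 1/(n+1) on [0,u]. Its minimum over [0,u] is therefore 0 and
  attained.\<close>

lemma SUP_level_debut:
  assumes cont: "continuous_on {0..} \<phi>" and nonneg: "\<And>s. 0 \<le> \<phi> s"
  shows "(SUP n. level_debut \<phi> n) = Inf {ennreal s | s. 0 \<le> s \<and> \<phi> s = 0}"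
proof (rule antisym)
  have "level_debut \<phi> n \<le> ennreal s" if "0 \<le> s" "\<phi> s = 0" for n s
    unfolding level_debut_def using that by (intro min.coboundedI2 Inf_lower) auto
  then show "(SUP n. level_debut \<phi> n) \<le> Inf {ennreal s | s. 0 \<le> s \<and> \<phi> s = 0}"
    by (intro SUP_least Inf_greatest) auto
  show "Inf {ennreal s | s. 0 \<le> s \<and> \<phi> s = 0} \<le> (SUP n. level_debut \<phi> n)"
  proof (rule dense_ge)
    fix y assume y: "(SUP n. level_debut \<phi> n) < y"
    show "Inf {ennreal s | s. 0 \<le> s \<and> \<phi> s = 0} \<le> y"
    proof (cases y)
      case (real u)
      have "{0..u} \<noteq> {}" using real by simp
      moreover have "continuous_on {0..u} \<phi>"
        using cont by (rule continuous_on_subset) auto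
      ultimately obtain z where z: "z \<in> {0..u}" "\<forall>s\<in>{0..u}. \<phi> z \<le> \<phi> s"
        using continuous_attains_inf[of "{0..u}" \<phi>] by auto
      obtain m where m: "u < real m"
        using reals_Archimedean2 by blast
      have "\<phi> z < 1 / real (Suc n)" if "n \<ge> m" for n
      proof -
        have "level_debut \<phi> n < ennreal u"
          using y real by (auto intro: le_less_trans[OF SUP_upper[of n]])
        moreover have "ennreal u < of_nat n"
          using m that real by (simp add: ennreal_of_nat_eq_real_of_nat ennreal_less_iff)
        ultimately have "Inf {ennreal s | s. 0 \<le> s \<and> \<phi> s < 1 / real (Suc n)} < ennreal u"
          unfolding level_debut_def by (auto simp: min_less_iff_disj)
        then obtain s where "0 \<le> s" "\<phi> s < 1 / real (Suc n)" "s < u"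
          by (auto simp: Inf_less_iff ennreal_less_iff)
        then show ?thesis using z(2) by (auto intro: le_less_trans)
      qed
      then have "\<forall>\<^sub>F n in sequentially. \<phi> z \<le> 1 / real (Suc n)"
        unfolding eventually_sequentially by (auto intro: less_imp_le)
      moreover have "(\<lambda>n. 1 / real (Suc n)) \<longlonglongrightarrow> 0"
        by (intro LIMSEQ_Suc lim_1_over_n)
      ultimately have "\<phi> z \<le> 0"
        by (intro tendsto_lowerbound[of "\<lambda>n. 1 / real (Suc n)"]) auto
      then have "\<phi> z = 0" using nonneg[of z] by simp
      then have "Inf {ennreal s | s. 0 \<le> s \<and> \<phi> s = 0} \<le> ennreal z"
        using z by (intro Inf_lower) auto
      also have "\<dots> \<le> y"
        using z real by (simp add: ennreal_leI)
      finally show ?thesis .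
    qed simp
  qed
qed

text \<open>The two conditions leave open whether \<open>T\<close> itself belongs to the section, so
  both interval types are covered.\<close>

lemma debut_compl_eqI:
  assumes pos: "\<And>t. 0 \<le> t \<Longrightarrow> ennreal t < T \<Longrightarrow> (\<omega>, t) \<in> B"
    and neg: "\<And>t. 0 \<le> t \<Longrightarrow> (\<omega>, t) \<in> B \<Longrightarrow> ennreal t \<le> T"
  shows "debut_compl B \<omega> = T"
  unfolding debut_compl_def
proof (rule antisym)
  show "T \<le> Inf {ennreal t | t. 0 \<le> t \<and> (\<omega>, t) \<notin> B}"
    using pos by (intro Inf_greatest) (auto simp: not_less[symmetric])
  show "Inf {ennreal t | t. 0 \<le> t \<and> (\<omega>, t) \<notin> B} \<le> T"
  proof (rule dense_ge)
    fix y assume y: "T < y"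
    show "Inf {ennreal t | t. 0 \<le> t \<and> (\<omega>, t) \<notin> B} \<le> y"
    proof (cases y)
      case (real u)
      then show ?thesis
        using y neg[of u] by (intro Inf_lower) auto
    qed simp
  qed
qed

context usual_filtered_space
begin

text \<open>Right-continuity of the path moves any time at which \<open>f\<close> is below the level
  to a rational time slightly later and still before \<open>u\<close>, so the event {... < u}
  becomes a countable union.\<close>

lemma stopping_time_level_debut:
  assumes f: "adapted_cont f"
  shows "is_stopping_time M F (\<lambda>\<omega>. level_debut (\<lambda>s. f (\<omega>, s)) n)"
proof (rule stopping_time_lessI)
  fix u :: real assume u: "0 < u"
  define I where "I = {q\<in>\<rat>. 0 \<le> q \<and> q < u}"
  have I: "countable I"
    unfolding I_def by (rule countable_subset[OF _ countable_rat]) auto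
  have "(\<exists>s. 0 \<le> s \<and> s < u \<and> f (\<omega>, s) < 1 / real (Suc n)) \<longleftrightarrow>
      (\<exists>q\<in>I. f (\<omega>, q) < 1 / real (Suc n))" if \<omega>: "\<omega> \<in> space M" for \<omega>
  proof
    assume "\<exists>s. 0 \<le> s \<and> s < u \<and> f (\<omega>, s) < 1 / real (Suc n)"
    then obtain s where s: "0 \<le> s" "s < u" "f (\<omega>, s) < 1 / real (Suc n)" by blast
    have "((\<lambda>s. f (\<omega>, s)) \<longlongrightarrow> f (\<omega>, s)) (at s within {0..})"
      using f \<omega> s(1) by (auto simp: adapted_cont_def continuous_on_def)
    then have "((\<lambda>s. f (\<omega>, s)) \<longlongrightarrow> f (\<omega>, s)) (at_right s)"
      by (rule tendsto_within_subset) (use s(1) in auto)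
    then have "\<forall>\<^sub>F q in at_right s. f (\<omega>, q) < 1 / real (Suc n)"
      using s(3) by (rule order_tendstoD)
    then obtain v where v: "s < v" "\<And>q. s < q \<Longrightarrow> q < v \<Longrightarrow> f (\<omega>, q) < 1 / real (Suc n)"
      by (auto simp: eventually_at_right_field)
    obtain q where "q \<in> \<rat>" "s < q" "q < min u v"
      using Rats_dense_in_real[of s "min u v"] s v(1) by auto
    then show "\<exists>q\<in>I. f (\<omega>, q) < 1 / real (Suc n)"
      using v(2) s(1) by (intro bexI[of _ q]) (auto simp: I_def)
  qed (auto simp: I_def)
  moreover have "level_debut (\<lambda>s. f (\<omega>, s)) n < ennreal u \<longleftrightarrow>
      of_nat n < ennreal u \<or> (\<exists>s. 0 \<le> s \<and> s < u \<and> f (\<omega>, s) < 1 / real (Suc n))" for \<omega>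
    by (auto simp: level_debut_def min_less_iff_disj Inf_less_iff ennreal_less_iff)
  ultimately have "{\<omega> \<in> space M. level_debut (\<lambda>s. f (\<omega>, s)) n < ennreal u} =
      (if of_nat n < ennreal u then space (F u)
       else (\<Union>q\<in>I. {\<omega> \<in> space (F u). f (\<omega>, q) < 1 / real (Suc n)}))"
    using u by auto
  moreover have "{\<omega> \<in> space (F u). f (\<omega>, q) < 1 / real (Suc n)} \<in> sets (F u)" if "q \<in> I" for q
  proof -
    have [measurable]: "(\<lambda>\<omega>. f (\<omega>, q)) \<in> borel_measurable (F u)"
      using f that by (intro borel_measurable_F_mono[of _ q u]) (auto simp: adapted_cont_def I_def)
    show ?thesis by measurable
  qed
  ultimately show "{\<omega> \<in> space M. level_debut (\<lambda>s. f (\<omega>, s)) n < ennreal u} \<in> sets (F u)"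
    using I by (auto intro!: sets.countable_UN'')
qed

section \<open>Existence of fundamental sequences for predictable sets of interval type\<close>

lemma predictable_open_ray:
  assumes C: "C \<in> sets (F q)" and q: "0 \<le> q"
  shows "C \<times> {q<..} \<in> sets (predictable_sigma M F)"
proof -
  have "{q<..} = (\<Union>n::nat. {q<..q + real (Suc n)})"
  proof safe
    fix x :: real
    obtain n where "x - q < real n" using reals_Archimedean2 by blast
    moreover assume "q < x"
    ultimately show "x \<in> (\<Union>n::nat. {q<..q + real (Suc n)})"
      by (intro UN_I[of n]) auto
  qed auto
  then have "C \<times> {q<..} = (\<Union>n::nat. C \<times> {q<..q + real (Suc n)})" by auto
  moreover have "C \<times> {q<..q + real (Suc n)} \<in> sets (predictable_sigma M F)" for n :: nat
    unfolding sets_predictable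
  proof (rule sigma_sets.Basic)
    have "q < q + real (Suc n)" by simp
    then show "C \<times> {q<..q + real (Suc n)} \<in> pred_gens"
      using C q by blast
  qed
  ultimately show ?thesis by auto
qed

lemma null_subset_sets_F:
  assumes "N \<in> null_sets M" "C \<subseteq> N" "0 \<le> t"
  shows "C \<in> sets (F t)"
proof -
  have "C \<in> null_sets M"
    using assms complete null_sets_subset by blast
  then show ?thesis
    using F_null F_mono[of 0 t] assms(3) by auto
qed

text \<open>Completeness and the usual conditions place every subset of \<open>N\<close> in each
  \<open>F t\<close>, so \<open>T\<close> may take arbitrary values on \<open>N\<close>.\<close>

lemma stopping_time_modify_null:
  assumes S: "is_stopping_time M F S" and N: "N \<in> null_sets M"
    and eq: "\<And>\<omega>. \<omega> \<in> space M - N \<Longrightarrow> T \<omega> = S \<omega>"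
  shows "is_stopping_time M F T"
  unfolding is_stopping_time_def
proof (intro allI impI)
  fix t :: real assume t: "0 \<le> t"
  have "{\<omega> \<in> space M. T \<omega> \<le> ennreal t} =
      ({\<omega> \<in> space M. S \<omega> \<le> ennreal t} - N) \<union> {\<omega> \<in> space M \<inter> N. T \<omega> \<le> ennreal t}"
    using eq by fastforce
  moreover have "{\<omega> \<in> space M. S \<omega> \<le> ennreal t} \<in> sets (F t)"
    using S t by (simp add: is_stopping_time_def)
  moreover have "N \<in> sets (F t)" "{\<omega> \<in> space M \<inter> N. T \<omega> \<le> ennreal t} \<in> sets (F t)"
    using N t by (auto intro: null_subset_sets_F)
  ultimately show "{\<omega> \<in> space M. T \<omega> \<le> ennreal t} \<in> sets (F t)"
    by auto
qed

lemma psit_fundamental_seq: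
  assumes "psit M F B"
  shows "\<exists>\<tau>. fundamental_seq M F B \<tau>"
proof -
  from assms obtain T :: "'a \<Rightarrow> ennreal" where B: "B \<in> sets (predictable_sigma M F)"
    and T [measurable]: "T \<in> borel_measurable M"
    and sect: "\<And>\<omega>. \<omega> \<in> space M \<Longrightarrow> {t. (\<omega>, t) \<in> B} \<noteq> {} \<and>
           ({t. (\<omega>, t) \<in> B} = {t. 0 \<le> t \<and> ennreal t < T \<omega>} \<or>
            {t. (\<omega>, t) \<in> B} = {t. 0 \<le> t \<and> ennreal t \<le> T \<omega>})"
    unfolding psit_def by blast
  have B_sub: "B \<subseteq> space M \<times> {0..}"
    using sets.sets_into_space[OF B] by (simp add: space_predictable)
  have sect': "(\<forall>t. (\<omega>, t) \<in> B \<longleftrightarrow> 0 \<le> t \<and> ennreal t < T \<omega>) \<or>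
      (\<forall>t. (\<omega>, t) \<in> B \<longleftrightarrow> 0 \<le> t \<and> ennreal t \<le> T \<omega>)" if "\<omega> \<in> space M" for \<omega>
    using sect[OF that] unfolding set_eq_iff mem_Collect_eq by blast
  have B_less: "(\<omega>, t) \<in> B" if "\<omega> \<in> space M" "0 \<le> t" "ennreal t < T \<omega>" for \<omega> t
    using sect'[OF that(1)] that(2,3) less_imp_le[OF that(3)] by blast
  have B_le: "ennreal t \<le> T \<omega>" if "\<omega> \<in> space M" "(\<omega>, t) \<in> B" for \<omega> t
    using sect'[OF that(1)] that(2) less_imp_le[of "ennreal t" "T \<omega>"] by blast
  \<comment> \<open>Consequently \<open>T\<close> is positive wherever it lies outside
    \<open>B\<close>, so the restriction to \<open>0 < r \<omega>\<close> in
    \<open>graph_event\<close> removes no point of \<open>G\<close>.\<close>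
  have B_0: "(\<omega>, 0) \<in> B" if \<omega>: "\<omega> \<in> space M" for \<omega>
  proof -
    obtain t where t: "(\<omega>, t) \<in> B" using sect[OF \<omega>] by auto
    have "0 < T \<omega>" if "ennreal t < T \<omega>"
      using that by (rule le_less_trans[OF zero_le])
    then have "ennreal 0 < T \<omega>" if "ennreal t < T \<omega>"
      using that by simp
    moreover have "ennreal 0 \<le> T \<omega>" by simp
    ultimately show ?thesis
      using sect'[OF \<omega>] t by blast
  qed

  \<comment> \<open>Measurability of \<open>T\<close> alone says nothing about the filtration; that
    comes from predictability of \<open>B\<close>, whose section at a rational q < u lies in
    \<open>F q\<close> and reveals an exit from \<open>B\<close> by time \<open>q\<close>.\<close>
  have stop_T: "is_stopping_time M F T"
  proof (rule stopping_time_lessI)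
    fix u :: real assume u: "0 < u"
    define I where "I = {q\<in>\<rat>. 0 \<le> q \<and> q < u}"
    have "T \<omega> < ennreal u \<longleftrightarrow> (\<exists>q\<in>I. (\<omega>, q) \<notin> B)" if \<omega>: "\<omega> \<in> space M" for \<omega>
    proof
      assume "T \<omega> < ennreal u"
      then obtain q where "q \<in> I" "T \<omega> < ennreal q"
        using exists_Rats_between by (auto simp: I_def)
      then show "\<exists>q\<in>I. (\<omega>, q) \<notin> B"
        using B_le[OF \<omega>, of q] by (auto simp: not_less[symmetric])
    next
      assume "\<exists>q\<in>I. (\<omega>, q) \<notin> B"
      then obtain q where "q \<in> I" "(\<omega>, q) \<notin> B" by blast
      then have "T \<omega> \<le> ennreal q" "ennreal q < ennreal u"
        using B_less[OF \<omega>, of q] by (auto simp: I_def not_less[symmetric] ennreal_less_iff)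
      then show "T \<omega> < ennreal u" by (rule le_less_trans)
    qed
    then have "{\<omega> \<in> space M. T \<omega> < ennreal u} =
        (\<Union>q\<in>I. space (F u) - {\<omega> \<in> space M. (\<omega>, q) \<in> B})"
      using u by auto
    also have "\<dots> \<in> sets (F u)"
    proof (rule sets.countable_UN'')
      show "countable I"
        unfolding I_def by (rule countable_subset[OF _ countable_rat]) auto
      fix q assume "q \<in> I"
      then have "{\<omega> \<in> space M. (\<omega>, q) \<in> B} \<in> sets (F u)"
        using predictable_section[OF B, of q] F_mono[of q u] by (auto simp: I_def)
      then show "space (F u) - {\<omega> \<in> space M. (\<omega>, q) \<in> B} \<in> sets (F u)"
        by (rule sets.compl_sets)
    qed
    finally show "{\<omega> \<in> space M. T \<omega> < ennreal u} \<in> sets (F u)" .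
  qed

  define Q where "Q = {q::real. q \<in> \<rat> \<and> 0 \<le> q}"
  have Q: "countable Q"
    unfolding Q_def by (rule countable_subset[OF _ countable_rat]) auto
  \<comment> \<open>Outside \<open>B\<close> and, by the removed rays, preceded by no rational time
    outside \<open>B\<close>: this leaves the exit point \<open>(\<omega>, T \<omega>)\<close>, if
    it lies outside \<open>B\<close>, by an expression that is visibly predictable.\<close>
  define G where "G = (space M \<times> {0..} - B) -
      (\<Union>q\<in>Q. (space M - {\<omega> \<in> space M. (\<omega>, q) \<in> B}) \<times> {q<..})"
  have G: "G \<in> sets (predictable_sigma M F)"
    unfolding G_def
  proof (rule sets.Diff)
    show "space M \<times> {0..} - B \<in> sets (predictable_sigma M F)"
      using sets.compl_sets[OF B] by (simp add: space_predictable)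
    show "(\<Union>q\<in>Q. (space M - {\<omega> \<in> space M. (\<omega>, q) \<in> B}) \<times> {q<..}) \<in> sets (predictable_sigma M F)"
    proof (rule sets.countable_UN''[OF Q], rule predictable_open_ray)
      fix q assume "q \<in> Q"
      then show "0 \<le> q" by (simp add: Q_def)
      then show "space M - {\<omega> \<in> space M. (\<omega>, q) \<in> B} \<in> sets (F q)"
        using sets.compl_sets[OF predictable_section[OF B, of q]] by simp
    qed
  qed
  have G_iff: "(\<omega>, t) \<in> G \<longleftrightarrow> T \<omega> = ennreal t \<and> (\<omega>, t) \<notin> B"
    if \<omega>: "\<omega> \<in> space M" and t: "0 \<le> t" for \<omega> t
  proof
    assume g: "(\<omega>, t) \<in> G"
    then have "T \<omega> \<le> ennreal t"
      using B_less[OF \<omega> t] by (auto simp: G_def not_less[symmetric])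
    moreover have "\<not> T \<omega> < ennreal t"
    proof
      assume "T \<omega> < ennreal t"
      then obtain q where q: "q \<in> Q" "T \<omega> < ennreal q" "q < t"
        using exists_Rats_between by (auto simp: Q_def)
      then have "(\<omega>, q) \<notin> B"
        using B_le[OF \<omega>, of q] by auto
      then show False using g q \<omega> by (auto simp: G_def)
    qed
    ultimately show "T \<omega> = ennreal t \<and> (\<omega>, t) \<notin> B"
      using g by (auto simp: G_def)
  next
    assume *: "T \<omega> = ennreal t \<and> (\<omega>, t) \<notin> B"
    have "(\<omega>, q) \<in> B" if "q \<in> Q" "q < t" for q
      using B_less[OF \<omega>, of q] that * by (auto simp: Q_def ennreal_less_iff)
    then show "(\<omega>, t) \<in> G"
      using * \<omega> t by (auto simp: G_def)
  qed

  \<comment> \<open>\<open>enn2real\<close> sends \<infinity> to 0. Since 0 belongs to every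
    section, an infinite \<open>T\<close> gives \<open>(\<omega>, r \<omega>) \<in> B\<close> and
    falls on the side where nothing has to be announced.\<close>
  define r where "r \<omega> = enn2real (T \<omega>)" for \<omega>
  have r: "r \<in> borel_measurable M" "0 \<le> r \<omega>" for \<omega>
    unfolding r_def by auto
  have "\<exists>f. adapted_cont f \<and> (\<forall>\<omega>\<in>space M. \<forall>s\<ge>0. f (\<omega>, s) = 0 \<longrightarrow> (\<omega>, s) \<in> G) \<and>
      prob (graph_event r G \<inter> {\<omega> \<in> space M. f (\<omega>, r \<omega>) \<noteq> 0}) \<le> (1/2) ^ k" for k :: nat
  proof -
    have "0 < (1/2::real) ^ k" by simp
    then show ?thesis
      by (rule predictable_inner_approx[OF r G, unfolded inner_approx_def, THEN spec, THEN mp])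
  qed
  from choice[OF allI[OF this]] obtain f where *: "\<forall>k. adapted_cont (f k) \<and>
      (\<forall>\<omega>\<in>space M. \<forall>s\<ge>0. f k (\<omega>, s) = 0 \<longrightarrow> (\<omega>, s) \<in> G) \<and>
      prob (graph_event r G \<inter> {\<omega> \<in> space M. f k (\<omega>, r \<omega>) \<noteq> 0}) \<le> (1/2) ^ k"
    by (rule exE)
  have f: "adapted_cont (f k)"
    "\<omega> \<in> space M \<Longrightarrow> 0 \<le> s \<Longrightarrow> f k (\<omega>, s) = 0 \<Longrightarrow> (\<omega>, s) \<in> G"
    "prob (graph_event r G \<inter> {\<omega> \<in> space M. f k (\<omega>, r \<omega>) \<noteq> 0}) \<le> (1/2) ^ k"
    for k \<omega> s
    using *[rule_format, of k] by blast+
  have f_cont: "continuous_on {0..} (\<lambda>s. f k (\<omega>, s))" if "\<omega> \<in> space M" for k \<omega>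
    using f(1)[of k] that by (simp add: adapted_cont_def)
  have f_nonneg: "0 \<le> f k p" for k p
    using f(1)[of k] unfolding adapted_cont_def by blast

  define R where "R k n \<omega> = level_debut (\<lambda>s. f k (\<omega>, s)) n" for k n \<omega>
  define S where "S k \<omega> = (SUP n. R k n \<omega>)" for k \<omega>
  have R_stop: "is_stopping_time M F (R k n)" for k n
    unfolding R_def using f(1) by (rule stopping_time_level_debut)
  have R [measurable]: "R k n \<in> borel_measurable M" for k n
    using R_stop by (rule stopping_time_borel_measurable)
  have S [measurable]: "S k \<in> borel_measurable M" for k
    unfolding S_def by measurable
  \<comment> \<open>The zeros of \<open>f k\<close> lie in \<open>G\<close>, so
    \<open>S k \<omega>\<close> is \<open>T \<omega>\<close> if \<open>f k\<close> vanishes there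
    and \<infinity> otherwise.\<close>
  have S_eq: "S k \<omega> = Inf {ennreal s | s. 0 \<le> s \<and> f k (\<omega>, s) = 0}" if "\<omega> \<in> space M" for k \<omega>
    unfolding S_def R_def using f_cont[OF that] f_nonneg by (rule SUP_level_debut)

  text \<open>\<open>A k n\<close> is the event that \<open>R k n\<close> is still far from the time \<open>S k\<close> that it announces.\<close>
  define A where "A k n = {\<omega> \<in> space M. R k n \<omega> < of_nat k \<and>
      R k n \<omega> + ennreal (1 / real (Suc k)) < S k \<omega>}" for k n
  have A [measurable]: "A k n \<in> sets M" for k n
    unfolding A_def by measurable
  have "\<exists>n. prob (A k n) \<le> (1/2) ^ k" for k
  proof -
    have "(\<lambda>n. prob (A k n)) \<longlonglongrightarrow> 0"
    proof (rule measure_tendsto_0_of_eventually_notin[OF A])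
      fix \<omega>
      have lim: "(\<lambda>n. R k n \<omega>) \<longlonglongrightarrow> S k \<omega>"
        unfolding S_def R_def using incseq_level_debut by (rule LIMSEQ_SUP)
      show "\<forall>\<^sub>F n in sequentially. \<omega> \<notin> A k n"
      \<comment> \<open>If \<open>S k \<omega>\<close> is infinite, \<open>R k n \<omega>\<close>
        eventually exceeds \<open>k\<close> and the first condition in \<open>A\<close> fails. If it
        is finite, the positive margin 1/(k+1) eventually makes the second one fail.\<close>
      proof (cases "S k \<omega> = \<top>")
        case True
        have "\<forall>\<^sub>F n in sequentially. of_nat k < R k n \<omega>"
          by (rule order_tendstoD(1)[OF lim]) (simp add: True of_nat_less_top)
        then show ?thesis
          by (rule eventually_mono) (auto simp: A_def)
      next
        case False
        have "(\<lambda>n. R k n \<omega> + ennreal (1 / real (Suc k))) \<longlonglongrightarrow> S k \<omega> + ennreal (1 / real (Suc k))"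
          using lim by (intro tendsto_add tendsto_const)
        moreover have "S k \<omega> < S k \<omega> + ennreal (1 / real (Suc k))"
          using False by (cases "S k \<omega>") (auto simp: ennreal_plus[symmetric] ennreal_less_iff simp del: ennreal_plus)
        ultimately have "\<forall>\<^sub>F n in sequentially. S k \<omega> < R k n \<omega> + ennreal (1 / real (Suc k))"
          by (rule order_tendstoD(1))
        then show ?thesis
          by (rule eventually_mono) (auto simp: A_def)
      qed
    qed
    then have "\<forall>\<^sub>F n in sequentially. prob (A k n) < (1/2) ^ k"
      by (rule order_tendstoD(2)) simp
    then show ?thesis
      by (auto simp: eventually_sequentially intro: less_imp_le)
  qed
  then have "\<forall>k. \<exists>n. prob (A k n) \<le> (1/2) ^ k" by blast
  from choice[OF this] obtain N where "\<forall>k. prob (A k (N k)) \<le> (1/2) ^ k"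
    by (rule exE)
  then have N: "prob (A k (N k)) \<le> (1/2) ^ k" for k by blast

  have ae: "AE \<omega> in M. \<forall>\<^sub>F k in sequentially. \<omega> \<in> space M - E k"
    if E: "\<And>k. E k \<in> sets M" and le: "\<And>k. prob (E k) \<le> (1/2) ^ k" for E
  proof (rule borel_cantelli_AE1[OF E])
    show "summable (\<lambda>k. prob (E k))"
      by (rule summable_comparison_test'[where g = "\<lambda>k. (1/2) ^ k" and N = 0])
         (use le in \<open>auto intro!: summable_geometric\<close>)
  qed (simp add: emeasure_eq_measure)
  have "AE \<omega> in M. \<forall>\<^sub>F k in sequentially. \<omega> \<in> space M - A k (N k)"
    by (intro ae A N)
  moreover have "AE \<omega> in M. \<forall>\<^sub>F k in sequentially. \<omega> \<in> space M -
      (graph_event r G \<inter> {\<omega> \<in> space M. f k (\<omega>, r \<omega>) \<noteq> 0})"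
    by (intro ae f(3) sets.Int graph_event_measurable G r adapted_cont_nonzero_event f(1))
  ultimately have "AE \<omega> in M. \<forall>\<^sub>F k in sequentially. \<omega> \<notin> A k (N k) \<and>
      \<not> (\<omega> \<in> graph_event r G \<and> f k (\<omega>, r \<omega>) \<noteq> 0)"
  proof eventually_elim
    case (elim \<omega>)
    then show ?case
      by eventually_elim auto
  qed
  then obtain N0 where N0: "N0 \<in> null_sets M"
    and good: "\<And>\<omega>. \<omega> \<in> space M - N0 \<Longrightarrow> \<forall>\<^sub>F k in sequentially. \<omega> \<notin> A k (N k) \<and>
      \<not> (\<omega> \<in> graph_event r G \<and> f k (\<omega>, r \<omega>) \<noteq> 0)"
    unfolding eventually_ae_filter by blast

  \<comment> \<open>The times \<open>R k (N k)\<close> need not increase with \<open>k\<close>; tail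
    infima do. The minimum with \<open>T\<close> supplies the right value where the tail infima tend
    to \<infinity>.\<close>
  define \<sigma> where "\<sigma> m \<omega> = min (INF k\<in>{m..}. R k (N k) \<omega>) (T \<omega>)" for m \<omega>
  \<comment> \<open>An exhaustion of the section of \<open>B\<close> chosen for each \<omega>
    separately: constant \<open>T\<close> for a closed section, times strictly below
    \<open>T\<close> for an open one. It anticipates \<open>T\<close>, which is admissible because
    it is used on a null set only.\<close>
  define \<alpha> where "\<alpha> m \<omega> = (if T \<omega> = \<top> then of_nat m else if (\<omega>, r \<omega>) \<in> B then T \<omega>
      else ennreal (r \<omega> * (1 - 1 / real (Suc m))))" for m \<omega>
  define \<tau> where "\<tau> m \<omega> = (if \<omega> \<in> N0 then \<alpha> m \<omega> else \<sigma> m \<omega>)" for m \<omega>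

  have T_r: "T \<omega> = ennreal (r \<omega>)" if "T \<omega> \<noteq> \<top>" for \<omega>
    using that by (cases "T \<omega>") (auto simp: r_def)
  have r_pos: "0 < r \<omega>" if "\<omega> \<in> space M" "(\<omega>, r \<omega>) \<notin> B" for \<omega>
    using that B_0[of \<omega>] r(2)[of \<omega>] by (cases "r \<omega> = 0") auto
  have B_eq: "(\<omega>, t) \<in> B \<longleftrightarrow> 0 \<le> t \<and> (if T \<omega> = \<top> then True else if (\<omega>, r \<omega>) \<in> B then t \<le> r \<omega> else t < r \<omega>)"
    if \<omega>: "\<omega> \<in> space M" for \<omega> t
  proof (cases "T \<omega> = \<top>")
    case True
    then show ?thesis using B_less[OF \<omega>, of t] B_sub by auto
  next
    case False
    note Tr = T_r[OF False]
    have le: "0 \<le> t \<and> t \<le> r \<omega>" if "(\<omega>, t) \<in> B"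
      using B_le[OF \<omega> that] Tr r(2)[of \<omega>] B_sub that by auto
    have less: "(\<omega>, t) \<in> B" if "0 \<le> t" "t < r \<omega>"
      using B_less[OF \<omega> that(1)] that Tr by (simp add: ennreal_less_iff)
    show ?thesis
    proof (cases "t = r \<omega>")
      case True
      show ?thesis by (simp add: True False r(2))
    next
      case neq: False
      have "(\<omega>, t) \<in> B \<longleftrightarrow> 0 \<le> t \<and> t < r \<omega>"
        using le less neq by argo
      moreover have "t \<le> r \<omega> \<longleftrightarrow> t < r \<omega>"
        using neq by argo
      ultimately show ?thesis
        using False by simp
    qed
  qed

  have \<alpha>_inc: "incseq (\<lambda>m. \<alpha> m \<omega>)" if "\<omega> \<in> space M" for \<omega>
  proof (rule incseq_SucI)
    fix m
    have "1 / real (Suc (Suc m)) \<le> 1 / real (Suc m)"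
      by (intro divide_left_mono) auto
    then have "r \<omega> * (1 - 1 / real (Suc m)) \<le> r \<omega> * (1 - 1 / real (Suc (Suc m)))"
      using r(2) by (intro mult_left_mono) auto
    then show "\<alpha> m \<omega> \<le> \<alpha> (Suc m) \<omega>"
      by (simp add: \<alpha>_def ennreal_leI del: of_nat_Suc)
  qed
  have \<alpha>_B: "(\<omega>, t) \<in> B \<longleftrightarrow> 0 \<le> t \<and> (\<exists>m. ennreal t \<le> \<alpha> m \<omega>)" if \<omega>: "\<omega> \<in> space M" for \<omega> t
  proof (cases "0 \<le> t")
    case t: True
    consider "T \<omega> = \<top>" | "T \<omega> \<noteq> \<top>" "(\<omega>, r \<omega>) \<in> B" | "T \<omega> \<noteq> \<top>" "(\<omega>, r \<omega>) \<notin> B" by blast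
    then show ?thesis
    proof cases
      case 1
      obtain m where "t < real m" using reals_Archimedean2 by blast
      then have "ennreal t \<le> of_nat m"
        by (simp add: ennreal_of_nat_eq_real_of_nat ennreal_leI)
      then show ?thesis
        using 1 t by (auto simp: B_eq[OF \<omega>] \<alpha>_def)
    next
      case 2
      then show ?thesis
        using t r(2)[of \<omega>] by (simp add: B_eq[OF \<omega>, of t] \<alpha>_def T_r)
    next
      case 3
      have rp: "0 < r \<omega>" using \<omega> 3(2) by (rule r_pos)
      have "t < r \<omega> \<longleftrightarrow> (\<exists>m. t \<le> r \<omega> * (1 - 1 / real (Suc m)))"
      proof
        assume "t < r \<omega>"
        then have "0 < (r \<omega> - t) / r \<omega>" using rp by simp
        then obtain m where "inverse (real (Suc m)) < (r \<omega> - t) / r \<omega>"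
          using reals_Archimedean by blast
        then have "r \<omega> * (1 / real (Suc m)) < r \<omega> - t"
          using rp by (simp add: pos_less_divide_eq inverse_eq_divide mult.commute del: of_nat_Suc)
        then show "\<exists>m. t \<le> r \<omega> * (1 - 1 / real (Suc m))"
          by (intro exI[of _ m]) (simp add: right_diff_distrib del: of_nat_Suc)
      next
        assume "\<exists>m. t \<le> r \<omega> * (1 - 1 / real (Suc m))"
        then obtain m where "t \<le> r \<omega> * (1 - 1 / real (Suc m))" ..
        also have "\<dots> < r \<omega> * 1"
          using rp by (intro mult_strict_left_mono) auto
        finally show "t < r \<omega>" by simp
      qed
      moreover have "ennreal t \<le> ennreal (r \<omega> * (1 - 1 / real (Suc m))) \<longleftrightarrow> t \<le> r \<omega> * (1 - 1 / real (Suc m))" for m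
        using rp by (intro ennreal_le_iff mult_nonneg_nonneg) auto
      ultimately show ?thesis
        using 3 t by (simp add: B_eq[OF \<omega>, of t] \<alpha>_def del: of_nat_Suc)
    qed
  qed (use B_sub in auto)

  have \<sigma>_inc: "incseq (\<lambda>m. \<sigma> m \<omega>)" for \<omega>
    unfolding \<sigma>_def by (intro incseq_SucI min.mono INF_superset_mono) auto
  have \<sigma>_B: "(\<omega>, t) \<in> B \<longleftrightarrow> 0 \<le> t \<and> (\<exists>m. ennreal t \<le> \<sigma> m \<omega>)"
    if \<omega>: "\<omega> \<in> space M - N0" for \<omega> t
  proof (cases "0 \<le> t")
    case t: True
    have \<omega>': "\<omega> \<in> space M" using \<omega> by simp
    obtain K where K: "\<And>k. K \<le> k \<Longrightarrow> \<omega> \<notin> A k (N k)"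
      "\<And>k. K \<le> k \<Longrightarrow> \<omega> \<in> graph_event r G \<Longrightarrow> f k (\<omega>, r \<omega>) = 0"
      using good[OF \<omega>] unfolding eventually_sequentially by blast
    show ?thesis
    proof (cases "T \<omega> \<noteq> \<top> \<and> (\<omega>, r \<omega>) \<notin> B")
      case True
      have "(\<omega>, s) \<in> G \<longleftrightarrow> s = r \<omega>" if "0 \<le> s" for s
        using True that r(2)[of \<omega>] by (auto simp: G_iff[OF \<omega>'] T_r)
      moreover have rp: "0 < r \<omega>" using \<omega>' True by (intro r_pos) auto
      ultimately have fz: "f k (\<omega>, r \<omega>) = 0" if "K \<le> k" for k
        using K(2)[OF that] \<omega>' by (auto simp: graph_event_def)
      \<comment> \<open>Inclusion of the zeros in \<open>G\<close> leaves \<open>r \<omega>\<close>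
        as the only candidate, and the choice of \<open>K\<close> makes it a zero.\<close>
      have S_r: "S k \<omega> = ennreal (r \<omega>)" if "K \<le> k" for k
      proof -
        have "{ennreal s | s. 0 \<le> s \<and> f k (\<omega>, s) = 0} = {ennreal (r \<omega>)}"
          using fz[OF that] f(2)[OF \<omega>'] \<open>\<And>s. 0 \<le> s \<Longrightarrow> (\<omega>, s) \<in> G \<longleftrightarrow> s = r \<omega>\<close> rp
          by (auto intro: less_imp_le)
        then show ?thesis by (simp add: S_eq[OF \<omega>'])
      qed
      have "(\<exists>m. ennreal t \<le> \<sigma> m \<omega>) \<longleftrightarrow> t < r \<omega>"
      proof
        assume "\<exists>m. ennreal t \<le> \<sigma> m \<omega>"
        then obtain m where "ennreal t \<le> \<sigma> m \<omega>" ..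
        \<comment> \<open>Raising the index to at least \<open>K\<close> ensures that
          \<open>r \<omega>\<close> is a zero of the process announced, so that
          \<open>level_debut_less_zero\<close> gives a strict bound.\<close>
        also have "\<sigma> m \<omega> \<le> R (max m K) (N (max m K)) \<omega>"
          unfolding \<sigma>_def by (intro min.coboundedI1 INF_lower) auto
        also have "\<dots> < ennreal (r \<omega>)"
          unfolding R_def by (rule level_debut_less_zero[OF f_cont[OF \<omega>'] fz rp]) simp
        finally show "t < r \<omega>" using t by (simp add: ennreal_less_iff)
      next
        assume "t < r \<omega>"
        then obtain m1 where m1: "inverse (real (Suc m1)) < r \<omega> - t"
          using reals_Archimedean[of "r \<omega> - t"] by auto
        obtain m2 where m2: "t < real m2" using reals_Archimedean2 by blast
        \<comment> \<open>From \<open>K\<close> on \<omega> avoids \<open>A k (N k)\<close>;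
          \<open>m1\<close> makes the margin 1/(k+1) smaller than \<open>r \<omega> - t\<close>;
          \<open>m2\<close> settles the case in which \<open>R k (N k) \<omega>\<close> is at least
          \<open>k\<close>.\<close>
        define m where "m = max K (max m1 m2)"
        have "ennreal t \<le> R k (N k) \<omega>" if "m \<le> k" for k
        proof -
          have k: "K \<le> k" "m1 \<le> k" "m2 \<le> k" using that by (auto simp: m_def)
          show ?thesis
          proof (cases "R k (N k) \<omega> < of_nat k")
            case True
            then have "ennreal (r \<omega>) \<le> R k (N k) \<omega> + ennreal (1 / real (Suc k))"
              using K(1)[OF k(1)] \<omega>' S_r[OF k(1)] by (auto simp: A_def not_less)
            moreover have "R k (N k) \<omega> < \<top>"
              using True by (rule less_trans) (rule of_nat_less_top)
            then obtain x where x: "R k (N k) \<omega> = ennreal x" "0 \<le> x"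
              by (cases "R k (N k) \<omega>") auto
            ultimately have "r \<omega> \<le> x + 1 / real (Suc k)"
              using rp by (simp add: ennreal_plus[symmetric] del: ennreal_plus of_nat_Suc)
            moreover have "1 / real (Suc k) \<le> inverse (real (Suc m1))"
              using k(2) by (simp add: inverse_eq_divide frac_le)
            ultimately have "t \<le> x" using m1 by linarith
            then show ?thesis by (simp add: x ennreal_leI)
          next
            case False
            have "ennreal t \<le> of_nat k"
              using m2 k(3) by (simp add: ennreal_of_nat_eq_real_of_nat ennreal_leI)
            also have "\<dots> \<le> R k (N k) \<omega>" using False by simp
            finally show ?thesis .
          qed
        qed
        then have "ennreal t \<le> \<sigma> m \<omega>"
          using \<open>t < r \<omega>\<close> True by (auto simp: \<sigma>_def T_r ennreal_leI intro: INF_greatest)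
        then show "\<exists>m. ennreal t \<le> \<sigma> m \<omega>" ..
      qed
      then show ?thesis
        using True t by (simp add: B_eq[OF \<omega>', of t])
    next
      case False
      \<comment> \<open>Here \<open>T\<close> is infinite or belongs to \<open>B\<close>. Every
        \<open>S k\<close> is then infinite, and avoiding \<open>A k (N k)\<close> forces
        \<open>R k (N k) \<omega>\<close> to be at least \<open>k\<close>. The tail infima pass
        every \<open>t\<close>, so only the bound by \<open>T\<close> remains.\<close>
      have "(\<omega>, s) \<notin> G" if "0 \<le> s" for s
        using False that by (auto simp: G_iff[OF \<omega>'] r_def)
      then have "{ennreal s | s. 0 \<le> s \<and> f k (\<omega>, s) = 0} = {}" for k
        using f(2)[OF \<omega>'] by auto
      then have S_top: "S k \<omega> = \<top>" for k
        by (simp only: S_eq[OF \<omega>'] Inf_empty)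
      obtain m2 where m2: "t < real m2" using reals_Archimedean2 by blast
      define m where "m = max K m2"
      have "ennreal t \<le> R k (N k) \<omega>" if "m \<le> k" for k
      proof -
        have k: "K \<le> k" "m2 \<le> k" using that by (auto simp: m_def)
        have "of_nat k \<le> R k (N k) \<omega>"
        proof (rule ccontr)
          assume "\<not> of_nat k \<le> R k (N k) \<omega>"
          then have less: "R k (N k) \<omega> < of_nat k" by simp
          then have "R k (N k) \<omega> < \<top>" by (rule less_trans) (rule of_nat_less_top)
          then have "\<omega> \<in> A k (N k)"
            using less \<omega>' by (auto simp: A_def S_top)
          then show False using K(1)[OF k(1)] by simp
        qed
        moreover have "ennreal t \<le> of_nat k"
          using m2 k(2) by (simp add: ennreal_of_nat_eq_real_of_nat ennreal_leI)
        ultimately show ?thesis by (rule order_trans[rotated])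
      qed
      then have "ennreal t \<le> (INF k\<in>{m..}. R k (N k) \<omega>)"
        by (auto intro: INF_greatest)
      then have "(\<exists>m. ennreal t \<le> \<sigma> m \<omega>) \<longleftrightarrow> ennreal t \<le> T \<omega>"
        by (auto simp: \<sigma>_def)
      also have "\<dots> \<longleftrightarrow> (\<omega>, t) \<in> B"
        using False t r(2)[of \<omega>] by (cases "T \<omega> = \<top>") (auto simp: B_eq[OF \<omega>', of t] T_r)
      finally show ?thesis using t by simp
    qed
  qed (use B_sub in auto)

  have "is_stopping_time M F (\<sigma> m)" for m
    unfolding \<sigma>_def by (intro stopping_time_min stopping_time_INF stop_T R_stop) auto
  then have "is_stopping_time M F (\<tau> m)" for m
    using N0 by (rule stopping_time_modify_null) (simp add: \<tau>_def)
  moreover have "incseq (\<lambda>m. \<tau> m \<omega>)" if "\<omega> \<in> space M" for \<omega>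
    using \<alpha>_inc[OF that] \<sigma>_inc[of \<omega>] by (auto simp: \<tau>_def incseq_def)
  moreover have "B = (\<Union>m. stoch_Icc M (\<lambda>_. 0) (\<tau> m))"
  proof -
    have "(\<omega>, t) \<in> B \<longleftrightarrow> \<omega> \<in> space M \<and> 0 \<le> t \<and> (\<exists>m. ennreal t \<le> \<tau> m \<omega>)" for \<omega> t
      using \<alpha>_B[of \<omega> t] \<sigma>_B[of \<omega> t] B_sub by (cases "\<omega> \<in> N0") (auto simp: \<tau>_def)
    then show ?thesis by (auto simp: stoch_Icc_def)
  qed
  ultimately show ?thesis
    unfolding fundamental_seq_def by blast
qed

end

section \<open>Stopping processes on a set of interval type\<close>

text \<open>The minimum of \<open>t\<close> and a possibly infinite \<open>u\<close>, as a real
  number; the minimum is finite, so \<open>enn2real\<close> loses nothing, and negative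
  \<open>t\<close> goes to 0. Stopping becomes a mere change of time, in place of the two-term
  formula of \<open>stopped\<close>.\<close>

definition clip :: "ennreal \<Rightarrow> real \<Rightarrow> real" where
  "clip u t = enn2real (min (ennreal t) u)"

lemma clip_nonneg: "0 \<le> clip u t"
  by (simp add: clip_def)

lemma clip_eq: "0 \<le> t \<Longrightarrow> ennreal t \<le> u \<Longrightarrow> clip u t = t"
  by (simp add: clip_def min_absorb1)

lemma clip_ennreal: "0 \<le> t \<Longrightarrow> 0 \<le> u \<Longrightarrow> clip (ennreal u) t = min t u"
  by (cases "t \<le> u") (simp_all add: clip_def min_absorb1 min_absorb2 ennreal_leI)

lemma borel_measurable_clip [measurable]:
  assumes [measurable]: "u \<in> borel_measurable N" "t \<in> borel_measurable N"
  shows "(\<lambda>x. clip (u x) (t x)) \<in> borel_measurable N"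
  unfolding clip_def by measurable

lemma stopped_eq_clip:
  assumes "\<omega> \<in> space M" "0 \<le> t"
  shows "stopped M X \<tau> (\<omega>, t) = X (\<omega>, clip (\<tau> \<omega>) t)"
proof (cases "ennreal t \<le> \<tau> \<omega>")
  case True
  then show ?thesis
    using assms by (simp add: stopped_def restr_def stoch_Icc_def stoch_Ioo_def clip_eq not_less)
next
  case False
  then have "clip (\<tau> \<omega>) t = enn2real (\<tau> \<omega>)"
    by (simp add: clip_def min_absorb2)
  then show ?thesis
    using assms False by (simp add: stopped_def restr_def stoch_Icc_def stoch_Ioo_def not_le)
qed

text \<open>For t \<le> u clipping is invisible on [0,t]; for later \<open>t\<close> the integral
  collapses to the one over [0,u]. Finiteness up to \<open>u\<close> thus becomes finiteness at all
  times.\<close>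

lemma abs_stieltjes_clip_finite:
  assumes fin: "\<And>t. 0 \<le> t \<Longrightarrow> ennreal t \<le> u \<Longrightarrow> abs_stieltjes h a t < \<infinity>" and t: "0 \<le> t"
  shows "abs_stieltjes (\<lambda>s. h (clip u s)) (\<lambda>s. a (clip u s)) t < \<infinity>"
proof (cases "ennreal t \<le> u")
  case True
  have "clip u s = s" if "0 \<le> s" "s \<le> t" for s
    using True that by (intro clip_eq) (auto intro: order_trans[OF ennreal_leI])
  then have "abs_stieltjes (\<lambda>s. h (clip u s)) (\<lambda>s. a (clip u s)) t = abs_stieltjes h a t"
    using t by (intro abs_stieltjes_cong) auto
  then show ?thesis using fin[OF t True] by simp
next
  case False
  then have "u < ennreal t" by simp
  then obtain v where v: "u = ennreal v" "0 \<le> v" "v \<le> t"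
    by (cases u) (auto simp: ennreal_less_iff)
  have "abs_stieltjes (\<lambda>s. h (clip u s)) (\<lambda>s. a (clip u s)) t =
      abs_stieltjes (\<lambda>s. h (min s v)) (\<lambda>s. a (min s v)) t"
    using v t by (intro abs_stieltjes_cong) (auto simp: clip_ennreal)
  also have "\<dots> = abs_stieltjes h a v"
    using v by (intro abs_stieltjes_stopped) auto
  also have "\<dots> < \<infinity>"
    using v by (intro fin) auto
  finally show ?thesis .
qed

section \<open>Cadlag paths of finite variation under stopping\<close>

lemma cadlag_path_cong:
  assumes a: "cadlag_path a" and eq: "\<And>t. 0 \<le> t \<Longrightarrow> b t = a t"
  shows "cadlag_path b"
  unfolding cadlag_path_def
proof (intro conjI allI impI)
  fix t :: real assume t: "0 \<le> t"
  have "(a \<longlongrightarrow> a t) (at_right t)"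
    using a t by (simp add: cadlag_path_def continuous_within)
  moreover have "\<forall>\<^sub>F s in at_right t. a s = b s"
    using t eq by (auto simp: eventually_at_filter intro!: always_eventually)
  ultimately have "(b \<longlongrightarrow> b t) (at_right t)"
    using eq[OF t] by (simp add: tendsto_cong)
  then show "continuous (at_right t) b"
    by (simp add: continuous_within)
next
  fix t :: real assume t: "0 < t"
  obtain l where l: "(a \<longlongrightarrow> l) (at_left t)"
    using a t by (auto simp: cadlag_path_def)
  have "\<forall>\<^sub>F s in at_left t. s \<in> {0<..<t}"
    using t by (rule eventually_at_left_real)
  then have "\<forall>\<^sub>F s in at_left t. a s = b s"
    by (rule eventually_mono) (simp add: eq)
  then have "(b \<longlongrightarrow> l) (at_left t)"
    using l by (simp add: tendsto_cong)
  then show "\<exists>l. (b \<longlongrightarrow> l) (at_left t)" ..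
qed

lemma cadlag_path_stopped:
  assumes a: "cadlag_path a" and u: "0 \<le> u"
  shows "cadlag_path (\<lambda>t. a (min t u))"
  unfolding cadlag_path_def
proof (intro conjI allI impI)
  fix t :: real assume t: "0 \<le> t"
  have "((\<lambda>s. a (min s u)) \<longlongrightarrow> a (min t u)) (at_right t)"
  proof (cases "t < u")
    case True
    have "(a \<longlongrightarrow> a t) (at_right t)"
      using a t by (simp add: cadlag_path_def continuous_within)
    moreover have "\<forall>\<^sub>F s in at_right t. s \<in> {t<..<u}"
      using True by (rule eventually_at_right_real)
    then have "\<forall>\<^sub>F s in at_right t. a s = a (min s u)"
      by (rule eventually_mono) simp
    ultimately show ?thesis
      using True by (simp add: tendsto_cong)
  next
    case False
    then have "\<forall>\<^sub>F s in at_right t. a (min s u) = a u"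
      by (auto simp: eventually_at_filter min_absorb2 intro!: always_eventually)
    then show ?thesis
      using False by (simp add: tendsto_eventually min_absorb2)
  qed
  then show "continuous (at_right t) (\<lambda>s. a (min s u))"
    by (simp add: continuous_within)
next
  fix t :: real assume t: "0 < t"
  show "\<exists>l. ((\<lambda>s. a (min s u)) \<longlongrightarrow> l) (at_left t)"
  proof (cases "t \<le> u")
    case True
    obtain l where l: "(a \<longlongrightarrow> l) (at_left t)"
      using a t by (auto simp: cadlag_path_def)
    have "\<forall>\<^sub>F s in at_left t. a s = a (min s u)"
      using True by (auto simp: eventually_at_filter min_absorb1 intro!: always_eventually)
    then have "((\<lambda>s. a (min s u)) \<longlongrightarrow> l) (at_left t)"
      using l by (simp add: tendsto_cong)
    then show ?thesis ..
  next
    case False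
    then have "u < t" by simp
    then have "\<forall>\<^sub>F s in at_left t. s \<in> {u<..<t}"
      by (rule eventually_at_left_real)
    then have "\<forall>\<^sub>F s in at_left t. a (min s u) = a u"
      by (rule eventually_mono) (simp add: min_absorb2)
    then have "((\<lambda>s. a (min s u)) \<longlongrightarrow> a u) (at_left t)"
      by (rule tendsto_eventually)
    then show ?thesis ..
  qed
qed

lemma cadlag_fv_path_clip:
  assumes a: "cadlag_path a" and fin: "\<And>t. 0 \<le> t \<Longrightarrow> variation a 0 t < \<infinity>"
  shows "cadlag_path (\<lambda>t. a (clip u t))"
    and "0 \<le> t \<Longrightarrow> variation (\<lambda>t. a (clip u t)) 0 t < \<infinity>"
proof -
  have "cadlag_path (\<lambda>t. a (clip u t)) \<and> (\<forall>t\<ge>0. variation (\<lambda>t. a (clip u t)) 0 t < \<infinity>)"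
  proof (cases u)
    case (real v)
    \<comment> \<open>The two differ at negative times, which is why cadlag paths and variation are
      transferred by congruences restricted to [0,\<infinity>[.\<close>
    have eq: "a (clip u t) = a (min t v)" if "0 \<le> t" for t
      using real that by (simp add: clip_ennreal)
    have "variation (\<lambda>t. a (clip u t)) 0 t = variation a 0 (min t v)" if "0 \<le> t" for t
      using variation_cong[of 0 t "\<lambda>t. a (clip u t)" "\<lambda>t. a (min t v)"] eq real
      by (simp add: variation_stopped)
    then show ?thesis
      using eq real fin by (auto intro: cadlag_path_cong[OF cadlag_path_stopped[OF a]])
  next
    case top
    have eq: "a (clip u t) = a t" if "0 \<le> t" for t
      using top that by (simp add: clip_eq)
    then have "variation (\<lambda>t. a (clip u t)) 0 t = variation a 0 t" for t
      by (intro variation_cong) auto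
    then show ?thesis
      using eq fin by (auto intro: cadlag_path_cong[OF a])
  qed
  then show "cadlag_path (\<lambda>t. a (clip u t))"
    "0 \<le> t \<Longrightarrow> variation (\<lambda>t. a (clip u t)) 0 t < \<infinity>"
    by auto
qed

section \<open>Stability of the two classes of processes under stopping\<close>

lemma measurable_processes_is_process:
  assumes "X \<in> measurable_processes M"
  shows "is_process M X"
  unfolding is_process_def
proof (intro allI impI)
  fix t :: real assume "0 \<le> t"
  then have "(\<lambda>\<omega>. (\<omega>, t)) \<in> M \<rightarrow>\<^sub>M M \<Otimes>\<^sub>M restrict_space borel {0..}"
    by (intro measurable_Pair2') (simp add: space_restrict_space)
  then show "(\<lambda>\<omega>. X (\<omega>, t)) \<in> borel_measurable M"
    using assms unfolding measurable_processes_def by (rule measurable_compose)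
qed

lemma measurable_processes_clip:
  assumes X: "X \<in> measurable_processes M" and T [measurable]: "T \<in> borel_measurable M"
  shows "(\<lambda>(\<omega>, t). X (\<omega>, clip (T \<omega>) t)) \<in> measurable_processes M"
proof -
  let ?N = "M \<Otimes>\<^sub>M restrict_space borel {0::real..}"
  have fst [measurable]: "fst \<in> ?N \<rightarrow>\<^sub>M M"
    by (rule measurable_fst)
  have snd [measurable]: "snd \<in> borel_measurable ?N"
    using measurable_snd by (rule measurable_compose) (simp add: measurable_restrict_space1)
  have "(\<lambda>p. clip (T (fst p)) (snd p)) \<in> borel_measurable ?N"
    by measurable
  then have "(\<lambda>p. (fst p, clip (T (fst p)) (snd p))) \<in> ?N \<rightarrow>\<^sub>M ?N"
    by (intro measurable_Pair fst measurable_restrict_space2) (auto simp: clip_nonneg)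
  then have "(\<lambda>p. X (fst p, clip (T (fst p)) (snd p))) \<in> borel_measurable ?N"
    using X unfolding measurable_processes_def by (rule measurable_compose)
  then show ?thesis
    by (simp add: measurable_processes_def case_prod_beta')
qed

text \<open>Membership provides measurability only at fixed times; at the random time
  \<open>clip (T \<omega>) t\<close> it comes from right-continuity of the paths.\<close>

lemma fv_processes_clip:
  assumes A: "A \<in> fv_processes M" and T [measurable]: "T \<in> borel_measurable M"
  shows "(\<lambda>(\<omega>, t). A (\<omega>, clip (T \<omega>) t)) \<in> fv_processes M"
proof -
  have "(\<lambda>\<omega>. A (\<omega>, clip (T \<omega>) t)) \<in> borel_measurable M" for t
  proof (rule borel_measurable_right_continuous_at_time)
    show "(\<lambda>\<omega>. A (\<omega>, s)) \<in> borel_measurable M" if "0 \<le> s" for s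
      using A that by (simp add: fv_processes_def is_process_def)
    show "continuous (at_right s) (\<lambda>s. A (\<omega>, s))" if "\<omega> \<in> space M" "0 \<le> s" for \<omega> s
      using A that by (simp add: fv_processes_def cadlag_path_def)
  qed (simp_all add: clip_nonneg)
  then show ?thesis
    using A cadlag_fv_path_clip[where a = "\<lambda>t. A (\<omega>, t)" and u = "T \<omega>" for \<omega>]
    by (auto simp: fv_processes_def is_process_def)
qed

section \<open>Fundamental sequences and coupled sequences\<close>

lemma fundamental_seq_iff:
  assumes "fundamental_seq M F B \<tau>"
  shows "(\<omega>, t) \<in> B \<longleftrightarrow> \<omega> \<in> space M \<and> 0 \<le> t \<and> (\<exists>n. ennreal t \<le> \<tau> n \<omega>)"
  using assms by (auto simp: fundamental_seq_def stoch_Icc_def)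

lemma fundamental_seq_downward:
  assumes "fundamental_seq M F B \<tau>" "(\<omega>, t) \<in> B" "0 \<le> s" "s \<le> t"
  shows "(\<omega>, s) \<in> B"
  using assms by (auto simp: fundamental_seq_iff intro: order_trans[OF ennreal_leI])

text \<open>Turns exhaustion of \<open>B\<close> into the convergence that
  \<open>coupled_seq\<close> asks for, so the times of a fundamental sequence can serve in a coupled
  sequence.\<close>

lemma fundamental_seq_tendsto_debut:
  assumes \<tau>: "fundamental_seq M F B \<tau>" and \<omega>: "\<omega> \<in> space M"
  shows "(\<lambda>n. \<tau> n \<omega>) \<longlonglongrightarrow> debut_compl B \<omega>"
proof -
  have "debut_compl B \<omega> = (SUP n. \<tau> n \<omega>)"
    using \<omega> by (intro debut_compl_eqI)
      (auto simp: fundamental_seq_iff[OF \<tau>] less_SUP_iff intro: less_imp_le SUP_upper2)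
  moreover have "incseq (\<lambda>n. \<tau> n \<omega>)"
    using \<tau> \<omega> by (simp add: fundamental_seq_def)
  ultimately show ?thesis
    by (simp add: LIMSEQ_SUP)
qed

text \<open>Countably many exceptional sets, one for each \<open>n\<close>, are merged into a single
  null set.\<close>

lemma coupled_seq_AE_eq:
  assumes "coupled_seq M F B X T Xn"
  shows "AE \<omega> in M. \<forall>n t. 0 \<le> t \<longrightarrow> (\<omega>, t) \<in> B \<longrightarrow> ennreal t \<le> T n \<omega> \<longrightarrow> X (\<omega>, t) = Xn n (\<omega>, t)"
proof -
  have "AE \<omega> in M. \<forall>t\<ge>0. restr X (B \<inter> stoch_Icc M (\<lambda>_. 0) (T n)) (\<omega>, t) =
      restr (Xn n) (B \<inter> stoch_Icc M (\<lambda>_. 0) (T n)) (\<omega>, t)" for n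
    using assms by (simp add: coupled_seq_def indistinguishable_def)
  then have "AE \<omega> in M. \<forall>n. \<forall>t\<ge>0. restr X (B \<inter> stoch_Icc M (\<lambda>_. 0) (T n)) (\<omega>, t) =
      restr (Xn n) (B \<inter> stoch_Icc M (\<lambda>_. 0) (T n)) (\<omega>, t)"
    by (simp add: AE_all_countable)
  then show ?thesis
  proof (rule AE_mp, intro AE_I2 impI allI)
    fix \<omega> n and t :: real
    assume \<omega>: "\<omega> \<in> space M" and t: "0 \<le> t" "(\<omega>, t) \<in> B" "ennreal t \<le> T n \<omega>"
      and eq: "\<forall>n. \<forall>t\<ge>0. restr X (B \<inter> stoch_Icc M (\<lambda>_. 0) (T n)) (\<omega>, t) =
      restr (Xn n) (B \<inter> stoch_Icc M (\<lambda>_. 0) (T n)) (\<omega>, t)"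
    have "(\<omega>, t) \<in> B \<inter> stoch_Icc M (\<lambda>_. 0) (T n)"
      using \<omega> t by (simp add: stoch_Icc_def)
    then show "X (\<omega>, t) = Xn n (\<omega>, t)"
      using eq[rule_format, OF t(1), of n] by (simp add: restr_def)
  qed
qed

lemma coupled_seq_covers:
  assumes "coupled_seq M F B X T Xn" "(\<omega>, t) \<in> B"
  shows "\<exists>n. ennreal t \<le> T n \<omega>"
proof -
  have "(\<omega>, t) \<in> (\<Union>n. stoch_Icc M (\<lambda>_. 0) (T n))"
    using assms unfolding coupled_seq_def by blast
  then show ?thesis by (auto simp: stoch_Icc_def)
qed

text \<open>Up to \<open>T n\<close>, which is at most \<open>S n\<close>, clipping changes nothing,
  so the coupling survives. What \<open>Xn n\<close> does after \<open>T n\<close> is discarded, and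
  there it is unrelated to \<open>X\<close>.\<close>

lemma coupled_seq_clip:
  assumes X: "coupled_seq M F B X S Xn" and T: "fundamental_seq M F B T"
    and le: "\<And>n \<omega>. \<omega> \<in> space M \<Longrightarrow> T n \<omega> \<le> S n \<omega>"
    and proc: "\<And>n. is_process M (\<lambda>(\<omega>, t). Xn n (\<omega>, clip (T n \<omega>) t))"
  shows "coupled_seq M F B X T (\<lambda>n (\<omega>, t). Xn n (\<omega>, clip (T n \<omega>) t))"
  unfolding coupled_seq_def
proof (intro conjI allI ballI)
  show "indistinguishable M (restr X (B \<inter> stoch_Icc M (\<lambda>_. 0) (T n)))
      (restr (\<lambda>(\<omega>, t). Xn n (\<omega>, clip (T n \<omega>) t)) (B \<inter> stoch_Icc M (\<lambda>_. 0) (T n)))" for n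
    unfolding indistinguishable_def
    using coupled_seq_AE_eq[OF X]
  proof (rule AE_mp, intro AE_I2 impI allI)
    fix \<omega> and t :: real
    assume "\<omega> \<in> space M" "0 \<le> t"
      and "\<forall>n t. 0 \<le> t \<longrightarrow> (\<omega>, t) \<in> B \<longrightarrow> ennreal t \<le> S n \<omega> \<longrightarrow> X (\<omega>, t) = Xn n (\<omega>, t)"
    then show "restr X (B \<inter> stoch_Icc M (\<lambda>_. 0) (T n)) (\<omega>, t) =
      restr (\<lambda>(\<omega>, t). Xn n (\<omega>, clip (T n \<omega>) t)) (B \<inter> stoch_Icc M (\<lambda>_. 0) (T n)) (\<omega>, t)"
      using le[of \<omega> n]
      by (cases "(\<omega>, t) \<in> B \<inter> stoch_Icc M (\<lambda>_. 0) (T n)")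
        (auto simp: restr_def stoch_Icc_def clip_eq)
  qed
  show "(\<lambda>n. T n \<omega>) \<longlonglongrightarrow> debut_compl B \<omega>" if "\<omega> \<in> space M" for \<omega>
    using T that by (rule fundamental_seq_tendsto_debut)
  show "B \<subseteq> (\<Union>n. stoch_Icc M (\<lambda>_. 0) (T n))"
    using T by (simp add: fundamental_seq_def)
qed (use T proc in \<open>auto simp: fundamental_seq_def\<close>)

section \<open>The two equivalences\<close>

context usual_filtered_space
begin

lemma integrable_on_iff_stopped:
  assumes B: "psit M F B"
  shows "integrable_on_wrt M B H A \<longleftrightarrow>
    (\<exists>\<tau>. fundamental_seq M F B \<tau> \<and>
       (\<forall>n. integrable_wrt M (stopped M H (\<tau> n)) (stopped M A (\<tau> n))))"
proof
  assume int: "integrable_on_wrt M B H A"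
  obtain \<tau> where \<tau>: "fundamental_seq M F B \<tau>"
    \<comment> \<open>Any fundamental sequence serves: its times stay inside \<open>B\<close>, where
      the integral is finite, and stopping adds nothing afterwards.\<close>
    using psit_fundamental_seq[OF B] by blast
  have "integrable_wrt M (stopped M H (\<tau> n)) (stopped M A (\<tau> n))" for n
    unfolding integrable_wrt_def using int[unfolded integrable_on_wrt_def]
  proof (rule AE_mp, intro AE_I2 impI allI)
    fix \<omega> and t :: real
    assume \<omega>: "\<omega> \<in> space M" and t: "0 \<le> t"
      and fin: "\<forall>t. (\<omega>, t) \<in> B \<longrightarrow> abs_stieltjes (\<lambda>s. H (\<omega>, s)) (\<lambda>s. A (\<omega>, s)) t < \<infinity>"
    have "abs_stieltjes (\<lambda>s. stopped M H (\<tau> n) (\<omega>, s)) (\<lambda>s. stopped M A (\<tau> n) (\<omega>, s)) t =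
        abs_stieltjes (\<lambda>s. H (\<omega>, clip (\<tau> n \<omega>) s)) (\<lambda>s. A (\<omega>, clip (\<tau> n \<omega>) s)) t"
      using \<omega> t by (intro abs_stieltjes_cong) (auto simp: stopped_eq_clip)
    also have "\<dots> < \<infinity>"
      by (rule abs_stieltjes_clip_finite[OF _ t])
         (use fin \<omega> in \<open>auto simp: fundamental_seq_iff[OF \<tau>]\<close>)
    finally show "abs_stieltjes (\<lambda>s. stopped M H (\<tau> n) (\<omega>, s))
        (\<lambda>s. stopped M A (\<tau> n) (\<omega>, s)) t < \<infinity>" .
  qed
  with \<tau> show "\<exists>\<tau>. fundamental_seq M F B \<tau> \<and>
       (\<forall>n. integrable_wrt M (stopped M H (\<tau> n)) (stopped M A (\<tau> n)))"
    by blast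
next
  assume "\<exists>\<tau>. fundamental_seq M F B \<tau> \<and>
       (\<forall>n. integrable_wrt M (stopped M H (\<tau> n)) (stopped M A (\<tau> n)))"
  then obtain \<tau> where \<tau>: "fundamental_seq M F B \<tau>"
    and int: "\<And>n. integrable_wrt M (stopped M H (\<tau> n)) (stopped M A (\<tau> n))"
    by blast
  have "AE \<omega> in M. \<forall>n. \<forall>t\<ge>0. abs_stieltjes (\<lambda>s. stopped M H (\<tau> n) (\<omega>, s))
      (\<lambda>s. stopped M A (\<tau> n) (\<omega>, s)) t < \<infinity>"
    using int by (simp add: AE_all_countable integrable_wrt_def)
  then show "integrable_on_wrt M B H A"
    unfolding integrable_on_wrt_def
  proof (rule AE_mp, intro AE_I2 impI allI)
    fix \<omega> and t :: real
    assume \<omega>: "\<omega> \<in> space M" and "(\<omega>, t) \<in> B"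
      and fin: "\<forall>n. \<forall>t\<ge>0. abs_stieltjes (\<lambda>s. stopped M H (\<tau> n) (\<omega>, s))
      (\<lambda>s. stopped M A (\<tau> n) (\<omega>, s)) t < \<infinity>"
    then obtain n where t: "0 \<le> t" "ennreal t \<le> \<tau> n \<omega>"
      by (auto simp: fundamental_seq_iff[OF \<tau>])
    have "clip (\<tau> n \<omega>) s = s" if "0 \<le> s" "s \<le> t" for s
      using t(2) that by (intro clip_eq) (auto intro: order_trans[OF ennreal_leI])
    then have "abs_stieltjes (\<lambda>s. H (\<omega>, s)) (\<lambda>s. A (\<omega>, s)) t =
        abs_stieltjes (\<lambda>s. stopped M H (\<tau> n) (\<omega>, s)) (\<lambda>s. stopped M A (\<tau> n) (\<omega>, s)) t"
      using \<omega> t by (intro abs_stieltjes_cong) (auto simp: stopped_eq_clip)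
    then show "abs_stieltjes (\<lambda>s. H (\<omega>, s)) (\<lambda>s. A (\<omega>, s)) t < \<infinity>"
      using fin t by simp
  qed
qed

text \<open>The times of a coupled sequence cover \<open>B\<close> but may overshoot it, by reaching
  the debut where it lies outside \<open>B\<close>. The minimum with \<tau> keeps them inside;
  monotonicity in \<open>n\<close> keeps the covering, at the largest of three indices.\<close>

lemma fundamental_seq_min:
  assumes \<tau>: "fundamental_seq M F B \<tau>"
    and X: "coupled_seq M F B X S Xn" and Y: "coupled_seq M F B Y S' Yn"
  shows "fundamental_seq M F B (\<lambda>n \<omega>. min (\<tau> n \<omega>) (min (S n \<omega>) (S' n \<omega>)))"
proof -
  define T where "T n \<omega> = min (\<tau> n \<omega>) (min (S n \<omega>) (S' n \<omega>))" for n \<omega>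
  have inc: "incseq (\<lambda>n. \<tau> n \<omega>)" "incseq (\<lambda>n. S n \<omega>)" "incseq (\<lambda>n. S' n \<omega>)"
    if "\<omega> \<in> space M" for \<omega>
    using assms that by (auto simp: fundamental_seq_def coupled_seq_def)
  have "is_stopping_time M F (T n)" for n
    unfolding T_def
    using assms by (intro stopping_time_min) (auto simp: fundamental_seq_def coupled_seq_def)
  moreover have "incseq (\<lambda>n. T n \<omega>)" if "\<omega> \<in> space M" for \<omega>
    unfolding T_def using inc[OF that] by (intro incseq_SucI min.mono) (auto dest: incseq_SucD)
  moreover have "(\<omega>, t) \<in> B \<longleftrightarrow> \<omega> \<in> space M \<and> 0 \<le> t \<and> (\<exists>n. ennreal t \<le> T n \<omega>)" for \<omega> t
  proof
    assume b: "(\<omega>, t) \<in> B"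
    then obtain k where \<omega>: "\<omega> \<in> space M" and t: "0 \<le> t" and k: "ennreal t \<le> \<tau> k \<omega>"
      by (auto simp: fundamental_seq_iff[OF \<tau>])
    obtain l m where l: "ennreal t \<le> S l \<omega>" and m: "ennreal t \<le> S' m \<omega>"
      using coupled_seq_covers[OF X b] coupled_seq_covers[OF Y b] by blast
    define n where "n = max k (max l m)"
    have "ennreal t \<le> T n \<omega>"
      unfolding T_def min.bounded_iff
      using order_trans[OF k incseqD[OF inc(1)[OF \<omega>], of k n]]
        order_trans[OF l incseqD[OF inc(2)[OF \<omega>], of l n]]
        order_trans[OF m incseqD[OF inc(3)[OF \<omega>], of m n]]
      by (simp add: n_def)
    then show "\<omega> \<in> space M \<and> 0 \<le> t \<and> (\<exists>n. ennreal t \<le> T n \<omega>)"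
      using \<omega> t by blast
  qed (auto simp: T_def fundamental_seq_iff[OF \<tau>])
  ultimately have "fundamental_seq M F B T"
    by (auto simp: fundamental_seq_def stoch_Icc_def)
  then show ?thesis
    by (simp add: T_def[abs_def])
qed

text \<open>The given coupled sequences for \<open>H\<close> and \<open>A\<close> may use different
  times, and their members may fail to be integrable after these. Passing to the common times
  \<open>T\<close> and stopping all members there cures both. Conversely, on [0,t] within
  \<open>B\<close> both paths agree almost surely with those of one pair \<open>Hn n\<close>,
  \<open>An n\<close>.\<close>

lemma integrable_on_iff_coupled:
  assumes B: "psit M F B"
    and H: "H \<in> class_on M F B (measurable_processes M)"
    and A: "A \<in> class_on M F B (fv_processes M)"
  shows "integrable_on_wrt M B H A \<longleftrightarrow>
    (\<exists>T Hn An. fund_coupled_seq M F B (measurable_processes M) H T Hn \<and>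
       fund_coupled_seq M F B (fv_processes M) A T An \<and>
       (\<forall>n. integrable_wrt M (Hn n) (An n)))"
proof
  assume int: "integrable_on_wrt M B H A"
  obtain S Hn where H: "coupled_seq M F B H S Hn" "\<And>n. Hn n \<in> measurable_processes M"
    using H by (auto simp: class_on_def fund_coupled_seq_def)
  obtain S' An where A: "coupled_seq M F B A S' An" "\<And>n. An n \<in> fv_processes M"
    using A by (auto simp: class_on_def fund_coupled_seq_def)
  obtain \<tau> where \<tau>: "fundamental_seq M F B \<tau>"
    using psit_fundamental_seq[OF B] by blast
  define T where "T n \<omega> = min (\<tau> n \<omega>) (min (S n \<omega>) (S' n \<omega>))" for n \<omega>
  have T: "fundamental_seq M F B T"
    using fundamental_seq_min[OF \<tau> H(1) A(1)] by (simp add: T_def[abs_def])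
  then have T_meas: "T n \<in> borel_measurable M" for n
    by (intro stopping_time_borel_measurable) (simp add: fundamental_seq_def)
  note clipped = measurable_processes_clip[OF H(2) T_meas] fv_processes_clip[OF A(2) T_meas]
  have "fund_coupled_seq M F B (measurable_processes M) H T (\<lambda>n (\<omega>, t). Hn n (\<omega>, clip (T n \<omega>) t))"
    unfolding fund_coupled_seq_def
    using clipped(1) by (intro conjI allI coupled_seq_clip[OF H(1) T] measurable_processes_is_process)
      (auto simp: T_def min_le_iff_disj)
  moreover have "fund_coupled_seq M F B (fv_processes M) A T (\<lambda>n (\<omega>, t). An n (\<omega>, clip (T n \<omega>) t))"
    unfolding fund_coupled_seq_def
    using clipped(2) by (intro conjI allI coupled_seq_clip[OF A(1) T])
      (auto simp: T_def fv_processes_def min_le_iff_disj)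
  moreover have "integrable_wrt M (\<lambda>(\<omega>, t). Hn n (\<omega>, clip (T n \<omega>) t))
      (\<lambda>(\<omega>, t). An n (\<omega>, clip (T n \<omega>) t))" for n
    unfolding integrable_wrt_def
    using AE_conjI[OF int[unfolded integrable_on_wrt_def]
        AE_conjI[OF coupled_seq_AE_eq[OF H(1)] coupled_seq_AE_eq[OF A(1)]]]
  proof (rule AE_mp, intro AE_I2 impI allI)
    fix \<omega> and t :: real
    assume \<omega>: "\<omega> \<in> space M" and t: "0 \<le> t"
      and *: "(\<forall>t. (\<omega>, t) \<in> B \<longrightarrow> abs_stieltjes (\<lambda>s. H (\<omega>, s)) (\<lambda>s. A (\<omega>, s)) t < \<infinity>) \<and>
        (\<forall>n t. 0 \<le> t \<longrightarrow> (\<omega>, t) \<in> B \<longrightarrow> ennreal t \<le> S n \<omega> \<longrightarrow> H (\<omega>, t) = Hn n (\<omega>, t)) \<and>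
        (\<forall>n t. 0 \<le> t \<longrightarrow> (\<omega>, t) \<in> B \<longrightarrow> ennreal t \<le> S' n \<omega> \<longrightarrow> A (\<omega>, t) = An n (\<omega>, t))"
    have "abs_stieltjes (\<lambda>s. Hn n (\<omega>, s)) (\<lambda>s. An n (\<omega>, s)) u < \<infinity>"
      if u: "0 \<le> u" "ennreal u \<le> T n \<omega>" for u
    proof -
      have B: "(\<omega>, s) \<in> B" "ennreal s \<le> S n \<omega>" "ennreal s \<le> S' n \<omega>" if "0 \<le> s" "s \<le> u" for s
      proof -
        have "ennreal s \<le> T n \<omega>"
          using u that by (auto intro: order_trans[OF ennreal_leI])
        then show "(\<omega>, s) \<in> B" "ennreal s \<le> S n \<omega>" "ennreal s \<le> S' n \<omega>"
          using \<omega> that by (auto simp: fundamental_seq_iff[OF T] T_def)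
      qed
      have "abs_stieltjes (\<lambda>s. H (\<omega>, s)) (\<lambda>s. A (\<omega>, s)) u =
          abs_stieltjes (\<lambda>s. Hn n (\<omega>, s)) (\<lambda>s. An n (\<omega>, s)) u"
        using * B u by (intro abs_stieltjes_cong) auto
      moreover have "abs_stieltjes (\<lambda>s. H (\<omega>, s)) (\<lambda>s. A (\<omega>, s)) u < \<infinity>"
        using * B(1)[of u] u by blast
      ultimately show ?thesis by simp
    qed
    then show "abs_stieltjes (\<lambda>s. case (\<omega>, s) of (\<omega>, t) \<Rightarrow> Hn n (\<omega>, clip (T n \<omega>) t))
        (\<lambda>s. case (\<omega>, s) of (\<omega>, t) \<Rightarrow> An n (\<omega>, clip (T n \<omega>) t)) t < \<infinity>"
      using t by (simp only: prod.case) (rule abs_stieltjes_clip_finite)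
  qed
  ultimately show "\<exists>T Hn An. fund_coupled_seq M F B (measurable_processes M) H T Hn \<and>
       fund_coupled_seq M F B (fv_processes M) A T An \<and>
       (\<forall>n. integrable_wrt M (Hn n) (An n))"
    by blast
next
  assume "\<exists>T Hn An. fund_coupled_seq M F B (measurable_processes M) H T Hn \<and>
       fund_coupled_seq M F B (fv_processes M) A T An \<and>
       (\<forall>n. integrable_wrt M (Hn n) (An n))"
  then obtain T Hn An where H: "coupled_seq M F B H T Hn" and A: "coupled_seq M F B A T An"
    and int: "\<And>n. integrable_wrt M (Hn n) (An n)"
    by (auto simp: fund_coupled_seq_def)
  \<comment> \<open>Gives a convenient description of \<open>B\<close>: its times are nonnegative
    and each section contains all earlier nonnegative times, so the coupling identities hold on the
    whole of [0,t].\<close>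
  obtain \<tau> where \<tau>: "fundamental_seq M F B \<tau>"
    using psit_fundamental_seq[OF B] by blast
  have "AE \<omega> in M. \<forall>n. \<forall>t\<ge>0. abs_stieltjes (\<lambda>s. Hn n (\<omega>, s)) (\<lambda>s. An n (\<omega>, s)) t < \<infinity>"
    using int by (simp add: AE_all_countable integrable_wrt_def)
  from AE_conjI[OF this AE_conjI[OF coupled_seq_AE_eq[OF H] coupled_seq_AE_eq[OF A]]]
  show "integrable_on_wrt M B H A"
    unfolding integrable_on_wrt_def
  proof (rule AE_mp, intro AE_I2 impI allI)
    fix \<omega> and t :: real
    assume *: "(\<forall>n. \<forall>t\<ge>0. abs_stieltjes (\<lambda>s. Hn n (\<omega>, s)) (\<lambda>s. An n (\<omega>, s)) t < \<infinity>) \<and>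
        (\<forall>n t. 0 \<le> t \<longrightarrow> (\<omega>, t) \<in> B \<longrightarrow> ennreal t \<le> T n \<omega> \<longrightarrow> H (\<omega>, t) = Hn n (\<omega>, t)) \<and>
        (\<forall>n t. 0 \<le> t \<longrightarrow> (\<omega>, t) \<in> B \<longrightarrow> ennreal t \<le> T n \<omega> \<longrightarrow> A (\<omega>, t) = An n (\<omega>, t))"
      and b: "(\<omega>, t) \<in> B"
    obtain n where n: "ennreal t \<le> T n \<omega>"
      using coupled_seq_covers[OF H b] by blast
    have t: "0 \<le> t"
      using b by (simp add: fundamental_seq_iff[OF \<tau>])
    have "(\<omega>, s) \<in> B \<and> ennreal s \<le> T n \<omega>" if "0 \<le> s" "s \<le> t" for s
      using fundamental_seq_downward[OF \<tau> b that] order_trans[OF ennreal_leI[OF that(2)] n] by simp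
    then have "abs_stieltjes (\<lambda>s. H (\<omega>, s)) (\<lambda>s. A (\<omega>, s)) t =
        abs_stieltjes (\<lambda>s. Hn n (\<omega>, s)) (\<lambda>s. An n (\<omega>, s)) t"
      using * t by (intro abs_stieltjes_cong) auto
    then show "abs_stieltjes (\<lambda>s. H (\<omega>, s)) (\<lambda>s. A (\<omega>, s)) t < \<infinity>"
      using * t by simp
  qed
qed

end

theorem theorem3p3:
  fixes M :: "'a measure" and F :: "real \<Rightarrow> 'a measure"
    and B :: "('a \<times> real) set" and H A :: "'a process"
  assumes "usual_filtered_space M F"
    and "psit M F B"
    and "H \<in> class_on M F B (measurable_processes M)"
    and "A \<in> class_on M F B (fv_processes M)"
  shows "(integrable_on_wrt M B H A \<longleftrightarrow>
            (\<exists>\<tau>. fundamental_seq M F B \<tau> \<and>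
               (\<forall>n. integrable_wrt M (stopped M H (\<tau> n)) (stopped M A (\<tau> n)))))
       \<and> (integrable_on_wrt M B H A \<longleftrightarrow>
            (\<exists>T Hn An. fund_coupled_seq M F B (measurable_processes M) H T Hn \<and>
               fund_coupled_seq M F B (fv_processes M) A T An \<and>
               (\<forall>n. integrable_wrt M (Hn n) (An n))))"
proof -
  interpret usual_filtered_space M F by fact
  show ?thesis
    using assms(2-4) by (intro conjI integrable_on_iff_stopped integrable_on_iff_coupled)
qed

end
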